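(* Let $K$ be a number field with ring of integers $\mathcal{O}$, $A$ a finite-dimensional semisimple $K$-algebra with centre $C$, $\mathcal{O}_C$ the integral closure of $\mathcal{O}$ in $C$, $\Lambda$ an $\mathcal{O}$-order in $A$, $\mathcal{M}$ a maximal $\mathcal{O}$-order with $\Lambda\subseteq\mathcal{M}$, $\mathfrak{f}$ a proper full two-sided ideal of $\mathcal{M}$ contained in $\Lambda$, and $\mathfrak{g}=\mathfrak{f}\cap C$. Let $X$ be a left ideal of $\Lambda$ with $X+\mathfrak{f}=\Lambda$, and suppose there is $\beta\in\mathcal{M}$ with $\mathcal{M}X=\mathcal{M}\beta$ (so that the image $\overline{\beta}$ of $\beta$ lies in $(\mathcal{M}/\mathfrak{f})^\times$). Then: (a) If $X$ is free over $\Lambda$, then $\pi_2(\overline{\mathrm{nr}}(\overline{\beta}))$ lies in the image of $\pi_2\circ f_2$. (b) If $f_1$ is surjective, then the converse of (a) holds. More precisely, if $u\in\mathcal{M}^\times$ and $\overline{a}\in(\Lambda/\mathfrak{f})^\times$ satisfy $\overline{\mathrm{nr}}(\overline{\beta})=\overline{\mathrm{nr}}(\overline{u})\,\overline{\mathrm{nr}}(\overline{a})$, then for any $v\in\mathrm{SL}(\mathcal{M})$ with $f_1(v)=\overline{\beta}\,\overline{a}^{-1}\overline{u}^{-1}$ we have $X=\Lambda\alpha$ where $\alpha:=(vu)^{-1}\beta$.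
   Context: Bars denote images modulo $\mathfrak{f}$ (resp. $\mathfrak{g}$); $(\Lambda/\mathfrak{f})^\times$ is a subgroup of $(\mathcal{M}/\mathfrak{f})^\times$. $\mathrm{nr}:A\to C$ is the reduced norm (defined componentwise on the simple components), restricting to $\mathrm{nr}:\mathcal{M}^\times\to\mathcal{O}_C^\times$. $\overline{\mathrm{nr}}:(\mathcal{M}/\mathfrak{f})^\times\to(\mathcal{O}_C/\mathfrak{g})^\times$ is the surjective homomorphism with $\overline{\mathrm{nr}}(\overline{x})=\overline{\mathrm{nr}(x)}$ for $x\in\mathcal{M}^\times$ (obtained from the reduced norms of the completions at primes dividing $\mathfrak{g}$ via the Chinese remainder theorem). $\mathrm{SL}(\mathcal{M})=\ker(\mathrm{nr}|_{\mathcal{M}^\times})$, $\mathrm{SL}(\mathcal{M}/\mathfrak{f})=\ker(\overline{\mathrm{nr}})$; $f_1:\mathrm{SL}(\mathcal{M})\to\mathrm{SL}(\mathcal{M}/\mathfrak{f})$ and $f_2:\mathrm{nr}(\mathcal{M}^\times)\to(\mathcal{O}_C/\mathfrak{g})^\times$ are induced by the canonical projections; $\pi_2:(\mathcal{O}_C/\mathfrak{g})^\times\to(\mathcal{O}_C/\mathfrak{g})^\times/\overline{\mathrm{nr}}((\Lambda/\mathfrak{f})^\times)$ is the quotient map. An $\mathcal{O}$-order is a subring with same unity that is a finitely generated $\mathcal{O}$-module containing a $K$-basis; full means containing a $K$-basis.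
   Formalization: In the converse in (b), freeness of X is concluded only when X is full (contains a K-basis of A), since it fails otherwise, e.g. Λ = M = Z×Z, f = 2Z×Z, X = Z×0, β = (1,0); that X = Λα for some α in Λ is proved without this assumption. *)

theory Defs
  imports
    "HOL-Algebra.Embedded_Algebras"
    "HOL-Algebra.Polynomials"
    "HOL-Algebra.Generated_Fields"
    "HOL-Algebra.Ideal_Product"
    "HOL-Algebra.QuotRing"
    "HOL-Algebra.Finite_Extensions"
    "Jordan_Normal_Form.Determinant"
begin

text \<open>
  A nonzero \<open>K\<close>-algebra is a ring \<open>A\<close> with a subfield \<open>K\<close> contained in its centre. Every
  other ring (the centre, orders, quotients) is \<open>A\<lparr>carrier := S\<rparr>\<close> for a subset \<open>S\<close>, or a
  quotient of such a ring, so that all operations and additive cosets are those of \<open>A\<close>.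
\<close>

definition centre :: "('a, 'b) ring_scheme \<Rightarrow> 'a set" where
  "centre R = {z \<in> carrier R. \<forall>x\<in>carrier R. z \<otimes>\<^bsub>R\<^esub> x = x \<otimes>\<^bsub>R\<^esub> z}"

definition left_ideal :: "'a set \<Rightarrow> ('a, 'b) ring_scheme \<Rightarrow> bool" where
  "left_ideal I R \<longleftrightarrow> additive_subgroup I R \<and> (\<forall>r\<in>carrier R. \<forall>x\<in>I. r \<otimes>\<^bsub>R\<^esub> x \<in> I)"

text \<open>The left regular module is semisimple: every submodule is a direct summand.\<close>
definition semisimple_ring :: "('a, 'b) ring_scheme \<Rightarrow> bool" where
  "semisimple_ring R \<longleftrightarrow> ring R \<and>
     (\<forall>I. left_ideal I R \<longrightarrow>
        (\<exists>J. left_ideal J R \<and> I \<inter> J = {\<zero>\<^bsub>R\<^esub>} \<and> I <+>\<^bsub>R\<^esub> J = carrier R))"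

text \<open>In characteristic zero, \<open>generate_field F {}\<close> is the copy of the rationals in \<open>F\<close>.\<close>
definition number_field :: "('a, 'b) ring_scheme \<Rightarrow> bool" where
  "number_field F \<longleftrightarrow> field F \<and>
     (\<forall>n::nat. n > 0 \<longrightarrow> [n] \<cdot>\<^bsub>F\<^esub> \<one>\<^bsub>F\<^esub> \<noteq> \<zero>\<^bsub>F\<^esub>) \<and>
     ring.finite_dimension F (generate_field F {}) (carrier F)"

text \<open>Polynomials are coefficient lists, leading coefficient first.\<close>
definition integral_closure :: "('a, 'b) ring_scheme \<Rightarrow> 'a set \<Rightarrow> 'a set \<Rightarrow> 'a set" where
  "integral_closure R S T =
     {x \<in> T. \<exists>p. set p \<subseteq> S \<and> p \<noteq> [] \<and> hd p = \<one>\<^bsub>R\<^esub> \<and> ring.eval R p x = \<zero>\<^bsub>R\<^esub>}"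

definition ring_of_integers :: "('a, 'b) ring_scheme \<Rightarrow> 'a set \<Rightarrow> 'a set" where
  "ring_of_integers A K = integral_closure A (range (\<lambda>n::int. [n] \<cdot>\<^bsub>A\<^esub> \<one>\<^bsub>A\<^esub>)) K"

text \<open>A subset of \<open>A\<close> is full if it contains a \<open>K\<close>-basis of \<open>A\<close>.\<close>
definition full :: "('a, 'b) ring_scheme \<Rightarrow> 'a set \<Rightarrow> 'a set \<Rightarrow> bool" where
  "full A K S \<longleftrightarrow>
     (\<exists>Us. set Us \<subseteq> S \<and> ring.independent A K Us \<and> ring.Span A K Us = carrier A)"

definition is_order :: "('a, 'b) ring_scheme \<Rightarrow> 'a set \<Rightarrow> 'a set \<Rightarrow> bool" where
  "is_order A K L \<longleftrightarrow> subring L A \<and>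
     (\<exists>Us. set Us \<subseteq> L \<and> ring.Span A (ring_of_integers A K) Us = L) \<and> full A K L"

definition is_maximal_order :: "('a, 'b) ring_scheme \<Rightarrow> 'a set \<Rightarrow> 'a set \<Rightarrow> bool" where
  "is_maximal_order A K M \<longleftrightarrow> is_order A K M \<and> (\<forall>N. is_order A K N \<and> M \<subseteq> N \<longrightarrow> N = M)"

text \<open>The left \<open>L\<close>-submodule \<open>N\<close> of \<open>A\<close> has a basis \<open>B\<close>; no restriction on the rank is imposed.\<close>
definition free_left_module :: "('a, 'b) ring_scheme \<Rightarrow> 'a set \<Rightarrow> 'a set \<Rightarrow> bool" where
  "free_left_module A L N \<longleftrightarrow>
     (\<exists>B\<subseteq>N. \<forall>x\<in>N. \<exists>!c.
        (\<forall>b\<in>B. c b \<in> L) \<and> (\<forall>b. b \<notin> B \<longrightarrow> c b = \<zero>\<^bsub>A\<^esub>) \<and>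
        finite {b. c b \<noteq> \<zero>\<^bsub>A\<^esub>} \<and>
        x = finsum A (\<lambda>b. c b \<otimes>\<^bsub>A\<^esub> b) {b. c b \<noteq> \<zero>\<^bsub>A\<^esub>})"


subsection \<open>The reduced norm\<close>

text \<open>
  The simple components of a semisimple ring \<open>A\<close> are the rings \<open>eA\<close> with identity \<open>e\<close>, for \<open>e\<close> a
  primitive central idempotent.
\<close>
definition central_primitive_idempotents :: "('a, 'b) ring_scheme \<Rightarrow> 'a set" where
  "central_primitive_idempotents A =
     {e \<in> centre A. e \<otimes>\<^bsub>A\<^esub> e = e \<and> e \<noteq> \<zero>\<^bsub>A\<^esub> \<and>
        (\<forall>d\<in>centre A. d \<otimes>\<^bsub>A\<^esub> d = d \<and> d \<otimes>\<^bsub>A\<^esub> e = d \<longrightarrow> d = \<zero>\<^bsub>A\<^esub> \<or> d = e)}"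

definition simple_component :: "('a, 'b) ring_scheme \<Rightarrow> 'a \<Rightarrow> ('a, 'b) ring_scheme" where
  "simple_component A e = A\<lparr>carrier := {e \<otimes>\<^bsub>A\<^esub> a | a. a \<in> carrier A}, one := e\<rparr>"

text \<open>
  Let \<open>B\<close> be a simple algebra whose centre \<open>F\<close> is a number field. An isomorphism of complex algebras
  from the scalar extension of \<open>B\<close> along an embedding \<open>\<sigma>\<close> of \<open>F\<close> onto the \<open>n \<times> n\<close> matrices is the
  same as a ring homomorphism \<open>h\<close> on \<open>B\<close> which restricts to \<open>\<sigma>\<close> (as scalar matrices) on \<open>F\<close> and sends
  an \<open>F\<close>-basis \<open>Us\<close> of \<open>B\<close> to a complex basis of the matrices. That \<open>\<sigma>\<close> is a homomorphism on \<open>F\<close>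
  follows from the first two conditions. The complex numbers contain every number field and are
  algebraically closed, so they are a splitting field for every such \<open>B\<close>.
\<close>
definition splitting ::
  "('a, 'b) ring_scheme \<Rightarrow> ('a \<Rightarrow> complex) \<Rightarrow> nat \<Rightarrow> ('a \<Rightarrow> complex mat) \<Rightarrow> bool" where
  "splitting B \<sigma> n h \<longleftrightarrow>
     h \<in> Ring.ring_hom B (ring_mat TYPE(complex) n ()) \<and>
     (\<forall>z\<in>centre B. h z = \<sigma> z \<cdot>\<^sub>m 1\<^sub>m n) \<and>
     (\<exists>Us. ring.independent B (centre B) Us \<and> ring.Span B (centre B) Us = carrier B \<and>
        (\<forall>T\<in>carrier_mat n n. \<exists>!cs. length cs = length Us \<and>
           (\<forall>i<n. \<forall>j<n. T $$ (i, j) = (\<Sum>k<length Us. cs ! k * h (Us ! k) $$ (i, j)))))"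

definition reduced_norm_simple :: "('a, 'b) ring_scheme \<Rightarrow> 'a \<Rightarrow> 'a" where
  "reduced_norm_simple B b =
     (THE z. z \<in> centre B \<and> (\<forall>\<sigma> n h. splitting B \<sigma> n h \<longrightarrow> \<sigma> z = det (h b)))"

definition reduced_norm :: "('a, 'b) ring_scheme \<Rightarrow> 'a \<Rightarrow> 'a" where
  "reduced_norm A a =
     finsum A (\<lambda>e. reduced_norm_simple (simple_component A e) (e \<otimes>\<^bsub>A\<^esub> a))
       (central_primitive_idempotents A)"

text \<open>
  \<open>\<nu>\<close> is the surjective homomorphism from the units of \<open>M/f\<close> to those of \<open>O\<^sub>C/g\<close>, with
  \<open>g = f \<inter> C\<close>, induced by the reduced norm. It is constructed from the reduced norms of the
  completions at the primes dividing \<open>g\<close>. An element \<open>x\<close> of \<open>M\<close> with invertible image in \<open>M/f\<close> is a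
  unit in each of these completions, and the reduced norms of the completions extend that of \<open>A\<close>, so
  \<open>\<nu>\<close> sends the class of \<open>x\<close> to the class of its reduced norm. This applies in particular to the
  units of \<open>M\<close>; imposing it for all such \<open>x\<close> makes \<open>\<nu>\<close> unique on the units of \<open>M/f\<close>, since not
  every unit of \<open>M/f\<close> lifts to a unit of \<open>M\<close>.
\<close>
definition is_reduced_norm_mod ::
  "('a, 'b) ring_scheme \<Rightarrow> 'a set \<Rightarrow> 'a set \<Rightarrow> 'a set \<Rightarrow> 'a set \<Rightarrow> ('a set \<Rightarrow> 'a set) \<Rightarrow> bool" where
  "is_reduced_norm_mod A M f O\<^sub>C g \<nu> \<longleftrightarrow>
     \<nu> \<in> hom (units_of (A\<lparr>carrier := M\<rparr> Quot f)) (units_of (A\<lparr>carrier := O\<^sub>C\<rparr> Quot g)) \<and>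
     \<nu> ` Units (A\<lparr>carrier := M\<rparr> Quot f) = Units (A\<lparr>carrier := O\<^sub>C\<rparr> Quot g) \<and>
     (\<forall>x\<in>M. f +>\<^bsub>A\<^esub> x \<in> Units (A\<lparr>carrier := M\<rparr> Quot f) \<longrightarrow>
        \<nu> (f +>\<^bsub>A\<^esub> x) = g +>\<^bsub>A\<^esub> reduced_norm A x)"

text \<open>The special linear groups of \<open>M\<close> and (for \<open>\<nu>\<close> as above) of \<open>M/f\<close>.\<close>
definition SL :: "('a, 'b) ring_scheme \<Rightarrow> 'a set \<Rightarrow> 'a set \<Rightarrow> 'a set" where
  "SL A M O\<^sub>C =
     kernel (units_of (A\<lparr>carrier := M\<rparr>)) (units_of (A\<lparr>carrier := O\<^sub>C\<rparr>)) (reduced_norm A)"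

definition SL_mod ::
  "('a, 'b) ring_scheme \<Rightarrow> 'a set \<Rightarrow> 'a set \<Rightarrow> 'a set \<Rightarrow> 'a set \<Rightarrow> ('a set \<Rightarrow> 'a set) \<Rightarrow> 'a set set"
  where
  "SL_mod A M f O\<^sub>C g \<nu> =
     kernel (units_of (A\<lparr>carrier := M\<rparr> Quot f)) (units_of (A\<lparr>carrier := O\<^sub>C\<rparr> Quot g)) \<nu>"

end

theory Submission
  imports Defs
begin

text \<open>
  Multiplying \<open>I + f = \<Lambda>\<close> by \<open>M\<close> shows that \<open>\<beta>\<close> is left invertible modulo \<open>f\<close>, and since \<open>M\<close> is finitely
  generated over a central subring, Nakayama's lemma makes it right invertible as well. It follows that
  \<open>I = M\<beta> \<inter> \<Lambda>\<close>, so that \<open>I\<close> is determined by \<open>M\<beta>\<close>.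

  If \<open>I\<close> is free, its rank is one because two independent elements would produce more independent
  elements of \<open>M\<close> than it has generators. With \<open>I = \<Lambda>\<alpha>\<close> one gets \<open>\<beta> = u\<alpha>\<close> for a unit \<open>u\<close> of \<open>M\<close>, and
  \<open>\<alpha>\<close> is a unit modulo \<open>f\<close> in \<open>\<Lambda>\<close>, which gives (a). Conversely, the choice of \<open>u\<close>, \<open>a\<close> and \<open>v\<close> in (b)
  makes \<open>\<alpha> = (vu)\<inverse>\<beta>\<close> congruent to \<open>a\<close>. Hence \<open>\<alpha>\<close> lies in \<open>\<Lambda>\<close>, is a unit there modulo \<open>f\<close>, and
  satisfies \<open>M\<alpha> = M\<beta>\<close>, so that \<open>I = M\<beta> \<inter> \<Lambda> = M\<alpha> \<inter> \<Lambda> = \<Lambda>\<alpha>\<close>. Of the reduced norm only its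
  compatibility with the homomorphism on the units modulo \<open>f\<close> enters.
\<close>

context ring begin

subsection \<open>One-sided inverses modulo an ideal\<close>

text \<open>
  The bicommutant of \<open>b\<close> is a commutative subring that contains \<open>b\<close> and the centre. It serves as ring
  of scalars, acting from the right, in place of the polynomial ring over the centre in \<open>b\<close>.
\<close>

definition bicommutant :: "'a \<Rightarrow> 'a set" where
  "bicommutant b = {s \<in> carrier R. \<forall>x\<in>carrier R. x \<otimes> b = b \<otimes> x \<longrightarrow> s \<otimes> x = x \<otimes> s}"

lemma bicommutant_subring:
  assumes "b \<in> carrier R"
  shows "subring (bicommutant b) R"
proof (rule subringI)
  fix s t assume *: "s \<in> bicommutant b" "t \<in> bicommutant b"
  have s: "s \<in> carrier R" "\<And>x. x \<in> carrier R \<Longrightarrow> x \<otimes> b = b \<otimes> x \<Longrightarrow> s \<otimes> x = x \<otimes> s"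
    and t: "t \<in> carrier R" "\<And>x. x \<in> carrier R \<Longrightarrow> x \<otimes> b = b \<otimes> x \<Longrightarrow> t \<otimes> x = x \<otimes> t"
    using * unfolding bicommutant_def by auto
  have "s \<otimes> t \<otimes> x = x \<otimes> (s \<otimes> t)" if "x \<in> carrier R" "x \<otimes> b = b \<otimes> x" for x
    using that s(1) t(1) s(2)[OF that] t(2)[OF that]
    by (metis m_assoc)
  thus "s \<otimes> t \<in> bicommutant b" using s(1) t(1) unfolding bicommutant_def by simp
  have "(s \<oplus> t) \<otimes> x = x \<otimes> (s \<oplus> t)" if "x \<in> carrier R" "x \<otimes> b = b \<otimes> x" for x
    using that(1) s(1) t(1) s(2)[OF that] t(2)[OF that] by (simp add: l_distr r_distr)
  thus "s \<oplus> t \<in> bicommutant b" using s(1) t(1) unfolding bicommutant_def by simp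
  have "\<ominus> s \<otimes> x = x \<otimes> \<ominus> s" if "x \<in> carrier R" "x \<otimes> b = b \<otimes> x" for x
    using that(1) s(1) s(2)[OF that] by (simp add: l_minus r_minus)
  thus "\<ominus> s \<in> bicommutant b" using s(1) unfolding bicommutant_def by simp
qed (auto simp: bicommutant_def)

lemma bicommutant_self: "b \<in> carrier R \<Longrightarrow> b \<in> bicommutant b"
  unfolding bicommutant_def by simp

lemma bicommutant_comm:
  "b \<in> carrier R \<Longrightarrow> s \<in> bicommutant b \<Longrightarrow> t \<in> bicommutant b \<Longrightarrow> s \<otimes> t = t \<otimes> s"
  unfolding bicommutant_def by blast

lemma centre_subset_bicommutant: "centre R \<subseteq> bicommutant b"
  unfolding bicommutant_def centre_def by blast

lemma diff_eq_diff_if_add_eq_add: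
  assumes "a \<in> carrier R" "x \<in> carrier R" "y \<in> carrier R" "z \<in> carrier R" "a \<oplus> x = y \<oplus> z"
  shows "a \<ominus> z = y \<ominus> x"
proof -
  have "a \<ominus> z = (a \<oplus> x) \<ominus> x \<ominus> z" using assms(1-4) by (simp add: minus_eq a_assoc r_neg)
  also have "\<dots> = y \<ominus> x" unfolding assms(5) using assms(1-4) by algebra
  finally show ?thesis .
qed

text \<open>
  One step of the determinant-free proof of Nakayama's lemma. Since \<open>b\<close> is left invertible modulo \<open>J\<close>,
  right multiplication by \<open>b\<close> is surjective on \<open>R/J\<close>, and the element \<open>\<one> \<ominus> p \<otimes> b\<close> that annihilates
  \<open>R\<close> modulo \<open>W + eS\<close> can be multiplied by a further factor of the same shape to absorb \<open>e\<close>.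
\<close>

lemma bicommutant_nakayama_step:
  assumes b: "b \<in> carrier R" and c: "c \<in> carrier R" and e: "e \<in> carrier R"
    and S: "S = bicommutant b" and J: "ideal J R" and cb: "c \<otimes> b \<in> J +> \<one>"
    and W: "subgroup W (add_monoid R)" "J \<subseteq> W" "\<And>w s. w \<in> W \<Longrightarrow> s \<in> S \<Longrightarrow> w \<otimes> s \<in> W"
    and p: "p \<in> S" "\<And>m. m \<in> carrier R \<Longrightarrow> m \<otimes> (\<one> \<ominus> p \<otimes> b) \<in> W <+>\<^bsub>R\<^esub> (\<lambda>s. e \<otimes> s) ` S"
  shows "\<exists>p\<in>S. \<forall>m\<in>carrier R. m \<otimes> (\<one> \<ominus> p \<otimes> b) \<in> W"
proof -
  interpret S: subring S R using bicommutant_subring b S by simp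
  interpret J: ideal J R by fact
  interpret W: subgroup W "add_monoid R" by fact
  have bS: "b \<in> S" using bicommutant_self b S by simp
  have Sc: "\<And>s. s \<in> S \<Longrightarrow> s \<in> carrier R" using S.subset by auto
  have Wc: "\<And>s. s \<in> W \<Longrightarrow> s \<in> carrier R" using W.subset by auto
  have Wa: "\<And>x y. x \<in> W \<Longrightarrow> y \<in> W \<Longrightarrow> x \<oplus> y \<in> W" using W.m_closed by simp
  have Wm: "\<And>x. x \<in> W \<Longrightarrow> \<ominus> x \<in> W" using W.m_inv_closed by (simp add: a_inv_def)
  have Sm: "\<And>x. x \<in> S \<Longrightarrow> \<ominus> x \<in> S" and Sa: "\<And>x y. x \<in> S \<Longrightarrow> y \<in> S \<Longrightarrow> x \<oplus> y \<in> S" and S1: "\<one> \<in> S"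
    and Smu: "\<And>x y. x \<in> S \<Longrightarrow> y \<in> S \<Longrightarrow> x \<otimes> y \<in> S"
    using subringE[OF S.subring_axioms] by auto
  have comm: "\<And>s t. s \<in> S \<Longrightarrow> t \<in> S \<Longrightarrow> s \<otimes> t = t \<otimes> s" using bicommutant_comm[OF b] S by simp
  define q where "q = \<one> \<ominus> p \<otimes> b"
  have q: "q \<in> S" unfolding q_def a_minus_def using p bS by (intro Sa Sm S1 Smu)
  obtain j where j: "j \<in> J" "c \<otimes> b = j \<oplus> \<one>" using cb by (auto simp: a_r_coset_def')
  \<comment> \<open>Modulo \<open>J\<close> the element \<open>e\<close> is congruent to
    \<open>e \<otimes> (c \<otimes> b)\<close>. The hypothesis is therefore applied to
    \<open>e \<otimes> c\<close>, and multiplication by \<open>b\<close> leads back to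
    \<open>e\<close>.\<close>
  obtain w s where w: "w \<in> W" "s \<in> S" "(e \<otimes> c) \<otimes> q = w \<oplus> e \<otimes> s"
    using p(2)[of "e \<otimes> c"] e c unfolding q_def set_add_def' by auto
  \<comment> \<open>Subtracting \<open>s \<otimes> b\<close> removes the component along
    \<open>e\<close>, so that \<open>e \<otimes> q'\<close> falls into \<open>W\<close>.\<close>
  define q' where "q' = q \<ominus> s \<otimes> b"
  have q': "q' \<in> S" unfolding q'_def a_minus_def using q w bS by (intro Sa Sm Smu)
  note carr = b c e Sc[OF q] Sc[OF q'] Sc[OF w(2)] Wc[OF w(1)] J.Icarr[OF j(1)]
  have "e \<otimes> q \<oplus> (e \<otimes> j) \<otimes> q = e \<otimes> (c \<otimes> b) \<otimes> q"
    using carr by (simp add: j(2) r_distr l_distr a_comm)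
  also have "\<dots> = (e \<otimes> c) \<otimes> q \<otimes> b"
    using carr by (simp add: m_assoc comm[OF bS q])
  also have "\<dots> = w \<otimes> b \<oplus> e \<otimes> (s \<otimes> b)"
    using carr by (simp add: w(3) l_distr m_assoc)
  finally have 1: "e \<otimes> q \<oplus> (e \<otimes> j) \<otimes> q = w \<otimes> b \<oplus> e \<otimes> (s \<otimes> b)" .
  have "e \<otimes> q' = e \<otimes> q \<ominus> e \<otimes> (s \<otimes> b)"
    using carr unfolding q'_def by (simp add: minus_eq r_distr r_minus)
  also have "\<dots> = w \<otimes> b \<ominus> (e \<otimes> j) \<otimes> q"
    using carr by (intro diff_eq_diff_if_add_eq_add[OF _ _ _ _ 1]) auto
  finally have "e \<otimes> q' = w \<otimes> b \<ominus> (e \<otimes> j) \<otimes> q" .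
  hence eq': "e \<otimes> q' \<in> W" using w(1) bS q j carr e W(2) 
    by (simp add: minus_eq Wa Wm W(3) subset_iff J.I_l_closed J.I_r_closed)
  have key: "m \<otimes> (q \<otimes> q') \<in> W" if m: "m \<in> carrier R" for m
  proof -
    obtain x t where x: "x \<in> W" "t \<in> S" "m \<otimes> q = x \<oplus> e \<otimes> t"
      using p(2)[of m] m unfolding q_def set_add_def' by auto
    have "m \<otimes> (q \<otimes> q') = x \<otimes> q' \<oplus> e \<otimes> (t \<otimes> q')"
      using carr m x Sc[OF x(2)] Wc[OF x(1)] by (simp add: m_assoc[symmetric] l_distr)
    also have "\<dots> = x \<otimes> q' \<oplus> (e \<otimes> q') \<otimes> t"
        using carr x Sc[OF x(2)] by (simp add: m_assoc comm[OF x(2) q'])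
    finally show ?thesis using x q' eq' W(3) Wa by simp
  qed
  have pc: "p \<in> carrier R" using p(1) Sc by simp
  \<comment> \<open>It remains to see that \<open>q \<otimes> q'\<close> is again
    \<open>\<one>\<close> minus an element of \<open>S\<close> times \<open>b\<close>. Commutativity
    of \<open>S\<close> collects \<open>b\<close> on the right.\<close>
  have "q \<otimes> q = q \<ominus> p \<otimes> b \<otimes> q"
    using carr pc by (subst q_def) (simp add: l_distr minus_eq l_minus)
  also have "p \<otimes> b \<otimes> q = p \<otimes> q \<otimes> b"
    using carr pc by (simp add: m_assoc comm[OF bS q])
  finally have 2: "q \<otimes> q = q \<ominus> p \<otimes> q \<otimes> b" .
  have 3: "q \<otimes> (s \<otimes> b) = s \<otimes> q \<otimes> b"
    using carr by (simp add: m_assoc[symmetric] comm[OF q w(2)])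
  have "q \<otimes> q' = q \<otimes> q \<ominus> q \<otimes> (s \<otimes> b)"
    using carr unfolding q'_def by (simp add: r_distr minus_eq r_minus)
  also have "\<dots> = \<one> \<ominus> (p \<oplus> p \<otimes> q \<oplus> s \<otimes> q) \<otimes> b"
    unfolding 2 3 using carr pc
    by (subst q_def) (simp add: minus_eq l_distr minus_add a_ac)
  finally have "q \<otimes> q' = \<one> \<ominus> (p \<oplus> p \<otimes> q \<oplus> s \<otimes> q) \<otimes> b" .
  moreover have "p \<oplus> p \<otimes> q \<oplus> s \<otimes> q \<in> S" using p w q by (intro Sa Smu)
  ultimately show ?thesis using key by (intro bexI[of _ "p \<oplus> p \<otimes> q \<oplus> s \<otimes> q"]) auto
qed

text \<open>Nakayama's lemma for \<open>R/J\<close> as a right module over the bicommutant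
  \<open>S\<close>: discarding the generators \<open>Us\<close> one at a time yields
  \<open>p\<close> in \<open>S\<close> with \<open>\<one> \<ominus> p \<otimes> b\<close> in
  \<open>J\<close>. As \<open>p\<close> commutes with \<open>b\<close>, it is a two-sided inverse
  modulo \<open>J\<close>, and the left inverse \<open>c\<close> must agree with it.\<close>

lemma left_inverse_mod_ideal_imp_right_inverse:
  assumes Z: "Z \<subseteq> centre R" and Us: "Span Z Us = carrier R" "set Us \<subseteq> carrier R"
    and J: "ideal J R" and b: "b \<in> carrier R" and c: "c \<in> carrier R"
    and cb: "c \<otimes> b \<in> J +> \<one>"
  shows "b \<otimes> c \<in> J +> \<one>"
proof -
  define S where "S = bicommutant b"
  interpret S: subring S R using bicommutant_subring b S_def by simp
  interpret J: ideal J R by fact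
  have Sc: "S \<subseteq> carrier R" using S.subset by simp
  have ZS: "Z \<subseteq> S" using Z centre_subset_bicommutant S_def by blast
  define W where "W = (\<lambda>es. foldr (\<lambda>e W. W <+>\<^bsub>R\<^esub> (\<lambda>s. e \<otimes> s) ` S) es J)"
  have W_Nil: "W [] = J" and W_Cons: "W (e # es) = W es <+>\<^bsub>R\<^esub> (\<lambda>s. e \<otimes> s) ` S" for e es
    unfolding W_def by simp_all
  have W: "subgroup (W es) (add_monoid R) \<and> J \<subseteq> W es \<and> (\<forall>w\<in>W es. \<forall>s\<in>S. w \<otimes> s \<in> W es) \<and> Span Z es \<subseteq> W es"
    if "set es \<subseteq> carrier R" for es
    using that
  proof (induction es)
    case Nil
    show ?case using J.additive_subgroup_axioms Sc unfolding W_Nil additive_subgroup_def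
      by (auto intro: J.I_r_closed)
  next
    case (Cons e es)
    hence e: "e \<in> carrier R" and IH: "subgroup (W es) (add_monoid R)" "J \<subseteq> W es"
      "\<And>w s. w \<in> W es \<Longrightarrow> s \<in> S \<Longrightarrow> w \<otimes> s \<in> W es" "Span Z es \<subseteq> W es" by auto
    have eS: "subgroup ((\<lambda>s. e \<otimes> s) ` S) (add_monoid R)"
    proof (rule add.subgroupI)
      fix x y assume "x \<in> (\<lambda>s. e \<otimes> s) ` S" "y \<in> (\<lambda>s. e \<otimes> s) ` S"
      then obtain s t where st: "s \<in> S" "t \<in> S" "x = e \<otimes> s" "y = e \<otimes> t" by auto
      show "\<ominus> x \<in> (\<lambda>s. e \<otimes> s) ` S"
        using st e Sc subringE(5)[OF S.subring_axioms st(1)]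
        by (intro image_eqI[of _ _ "\<ominus> s"]) (auto simp: r_minus)
      show "x \<oplus> y \<in> (\<lambda>s. e \<otimes> s) ` S"
        using st e Sc subringE(7)[OF S.subring_axioms st(1,2)]
        by (intro image_eqI[of _ _ "s \<oplus> t"]) (auto simp: r_distr)
    qed (use e Sc subringE(4)[OF S.subring_axioms] in auto)
    have Wc: "W es \<subseteq> carrier R" using subgroup.subset[OF IH(1)] by simp
    have sub: "subgroup (W (e # es)) (add_monoid R)"
      using add_additive_subgroups[of "W es" "(\<lambda>s. e \<otimes> s) ` S"] IH(1) eS
      unfolding W_Cons additive_subgroup_def by simp
    have sup: "W es \<subseteq> W (e # es)"
    proof
      fix w assume "w \<in> W es"
      moreover have "w = w \<oplus> e \<otimes> \<zero>" using e Wc \<open>w \<in> W es\<close> by auto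
      ultimately show "w \<in> W (e # es)"
        using subringE(2)[OF S.subring_axioms] unfolding W_Cons set_add_def' by blast
    qed
    have cl: "w \<otimes> s \<in> W (e # es)" if w: "w \<in> W (e # es)" and s: "s \<in> S" for w s
    proof -
      obtain x t where x: "x \<in> W es" "t \<in> S" "w = x \<oplus> e \<otimes> t"
        using w unfolding W_Cons set_add_def' by auto
      have "w \<otimes> s = x \<otimes> s \<oplus> e \<otimes> (t \<otimes> s)" using x s e Sc Wc
        by (auto simp: l_distr m_assoc subset_iff)
      thus ?thesis using IH(3)[OF x(1) s] subringE(6)[OF S.subring_axioms x(2) s]
        unfolding W_Cons set_add_def' by auto
    qed
    have "Span Z (e # es) \<subseteq> W (e # es)"
    proof
      fix x assume "x \<in> Span Z (e # es)"
      then obtain z y where z: "z \<in> Z" "y \<in> Span Z es" "x = z \<otimes> e \<oplus> y"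
        by (auto simp: line_extension_def set_add_def' r_coset_def)
      have "y \<in> carrier R" "z \<in> carrier R" using z IH(4) Wc ZS Sc by auto
      \<comment> \<open>Centrality of \<open>z\<close> turns the left coefficient into a right
        one.\<close>
      hence "x = y \<oplus> e \<otimes> z" using z Z e a_comm unfolding centre_def by force
      thus "x \<in> W (e # es)" using z IH(4) ZS unfolding W_Cons set_add_def' by auto
    qed
    thus ?case using sub sup IH(2) cl by blast
  qed
  have red: "(\<exists>p\<in>S. \<forall>m\<in>carrier R. m \<otimes> (\<one> \<ominus> p \<otimes> b) \<in> W es) \<Longrightarrow>
      \<exists>p\<in>S. \<forall>m\<in>carrier R. m \<otimes> (\<one> \<ominus> p \<otimes> b) \<in> J" if "set es \<subseteq> carrier R" for es
    using that
  proof (induction es)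
    case Nil thus ?case by (simp add: W_Nil)
  next
    case (Cons e es)
    from Cons.prems(1) obtain p where p: "p \<in> S"
      "\<And>m. m \<in> carrier R \<Longrightarrow> m \<otimes> (\<one> \<ominus> p \<otimes> b) \<in> W es <+>\<^bsub>R\<^esub> (\<lambda>s. e \<otimes> s) ` S"
      unfolding W_Cons by blast
    have "\<exists>p\<in>S. \<forall>m\<in>carrier R. m \<otimes> (\<one> \<ominus> p \<otimes> b) \<in> W es"
      using W[of es] Cons.prems(2) by (intro bicommutant_nakayama_step[OF b c _ S_def J cb _ _ _ p]) auto
    thus ?case using Cons.IH Cons.prems(2) by simp
  qed
  \<comment> \<open>With all generators present \<open>W Us\<close> is the whole ring, so the
    descent starts with \<open>p = \<zero>\<close>.\<close>
  have "\<exists>p\<in>S. \<forall>m\<in>carrier R. m \<otimes> (\<one> \<ominus> p \<otimes> b) \<in> W Us"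
    using W[OF Us(2)] Us b subringE(2)[OF S.subring_axioms]
    by (intro bexI[of _ \<zero>]) (auto simp: minus_eq)
  from red[OF Us(2) this] obtain p where p: "p \<in> S" "\<And>m. m \<in> carrier R \<Longrightarrow> m \<otimes> (\<one> \<ominus> p \<otimes> b) \<in> J" by blast
  have pc: "p \<in> carrier R" using p Sc by auto
  define x where "x = \<one> \<ominus> b \<otimes> p"
  have x: "x \<in> J" using p(2)[of \<one>] bicommutant_comm[OF b bicommutant_self[OF b], of p] p(1) pc b
    unfolding S_def x_def by simp
  obtain j where j: "j \<in> J" "c \<otimes> b = j \<oplus> \<one>" using cb by (auto simp: a_r_coset_def')
  note carr = b c pc J.Icarr[OF j(1)] J.Icarr[OF x]
  have bp: "b \<otimes> p = \<one> \<ominus> x" unfolding x_def using b pc by algebra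
  \<comment> \<open>Inserting this form of \<open>\<one>\<close> to the right of
    \<open>b \<otimes> c\<close> produces the inner product \<open>c \<otimes> b\<close>, which is
    \<open>\<one>\<close> modulo \<open>J\<close>; what remains is \<open>b \<otimes> p\<close>,
    again \<open>\<one>\<close> modulo \<open>J\<close>.\<close>
  have "x \<oplus> b \<otimes> p = \<one>" unfolding bp using carr by algebra
  hence "b \<otimes> c = b \<otimes> c \<otimes> (x \<oplus> b \<otimes> p)" using carr by simp
  also have "\<dots> = b \<otimes> c \<otimes> x \<oplus> b \<otimes> (c \<otimes> b) \<otimes> p" using carr by (simp add: r_distr m_assoc)
  also have "\<dots> = (b \<otimes> c \<otimes> x \<oplus> b \<otimes> j \<otimes> p \<ominus> x) \<oplus> \<one>"
    using carr by (simp add: j(2) r_distr l_distr bp minus_eq a_ac)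
  finally have "b \<otimes> c = (b \<otimes> c \<otimes> x \<oplus> b \<otimes> j \<otimes> p \<ominus> x) \<oplus> \<one>" .
  moreover have "b \<otimes> c \<otimes> x \<oplus> b \<otimes> j \<otimes> p \<ominus> x \<in> J"
    using carr j(1) x by (simp add: minus_eq J.a_closed J.I_l_closed J.I_r_closed J.a_inv_closed)
  ultimately show ?thesis unfolding a_r_coset_def' by blast
qed

subsection \<open>Linear dependence over a domain\<close>

lemma Span_subset_carrier:
  assumes "D \<subseteq> carrier R" "set Us \<subseteq> carrier R" shows "Span D Us \<subseteq> carrier R"
  using assms(2)
proof (induction Us)
  case (Cons a Us)
  thus ?case using assms(1) by (fastforce simp: line_extension_def set_add_def' r_coset_def)
qed simp

lemma Span_subring_add_closed:
  assumes D: "subring D R"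
  shows "set Us \<subseteq> carrier R \<Longrightarrow> x \<in> Span D Us \<Longrightarrow> y \<in> Span D Us \<Longrightarrow> x \<oplus> y \<in> Span D Us"
proof (induction Us arbitrary: x y)
  case (Cons a Us)
  obtain k l v w where kl: "k \<in> D" "l \<in> D" "v \<in> Span D Us" "w \<in> Span D Us"
    "x = k \<otimes> a \<oplus> v" "y = l \<otimes> a \<oplus> w"
    using Cons.prems(2,3) by (auto simp: line_extension_def set_add_def' r_coset_def)
  have "v \<in> carrier R" "w \<in> carrier R" "k \<in> carrier R" "l \<in> carrier R"
    using kl subringE(1)[OF D] Span_subset_carrier[OF subringE(1)[OF D]] Cons.prems(1) by auto
  hence "x \<oplus> y = (k \<oplus> l) \<otimes> a \<oplus> (v \<oplus> w)" using kl Cons.prems(1) by (simp add: l_distr a_ac)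
  thus ?case using Cons.IH[OF _ kl(3,4)] Cons.prems(1) subringE(7)[OF D kl(1,2)]
    by (auto simp: line_extension_def set_add_def' r_coset_def)
qed simp

lemma Span_subring_smult_closed:
  assumes D: "subring D R" and d: "d \<in> D"
  shows "set Us \<subseteq> carrier R \<Longrightarrow> x \<in> Span D Us \<Longrightarrow> d \<otimes> x \<in> Span D Us"
proof (induction Us arbitrary: x)
  case Nil thus ?case using d subringE(1)[OF D] by auto
next
  case (Cons a Us)
  obtain k v where kl: "k \<in> D" "v \<in> Span D Us" "x = k \<otimes> a \<oplus> v"
    using Cons.prems(2) by (auto simp: line_extension_def set_add_def' r_coset_def)
  have "v \<in> carrier R" "k \<in> carrier R" "d \<in> carrier R"
    using kl d subringE(1)[OF D] Span_subset_carrier[OF subringE(1)[OF D]] Cons.prems(1) by auto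
  hence "d \<otimes> x = (d \<otimes> k) \<otimes> a \<oplus> d \<otimes> v" using kl Cons.prems(1) by (simp add: r_distr m_assoc)
  thus ?case using Cons.IH[OF _ kl(2)] Cons.prems(1) subringE(6)[OF D d kl(1)]
    by (auto simp: line_extension_def set_add_def' r_coset_def)
qed

lemma finsum_in_subring:
  assumes D: "subring D R" and "finite F" "\<And>i. i \<in> F \<Longrightarrow> g i \<in> D"
  shows "finsum R g F \<in> D"
  using assms(2,3)
proof (induction F)
  case empty thus ?case using subringE(2)[OF D] by simp
next
  case (insert i F)
  hence "finsum R g (insert i F) = g i \<oplus> finsum R g F"
    using subringE(1)[OF D] by (intro finsum_insert) auto
  thus ?case using insert subringE(7)[OF D] by simp
qed

lemma diff_add_left:
  "\<lbrakk>x \<in> carrier R; y \<in> carrier R; z \<in> carrier R\<rbrakk> \<Longrightarrow> (x \<oplus> y) \<ominus> (x \<oplus> z) = y \<ominus> z"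
  by algebra

text \<open>
  The elimination multiplies by a pivot coefficient instead of dividing, so that it works over any
  domain.
\<close>

lemma finsum_dependent:
  assumes D: "subdomain D R"
  shows "\<lbrakk>set Us \<subseteq> carrier R; finite F; length Us < card F; \<And>i::'i. i \<in> F \<Longrightarrow> v i \<in> Span D Us\<rbrakk> \<Longrightarrow>
    \<exists>c. (\<forall>i\<in>F. c i \<in> D) \<and> (\<exists>i\<in>F. c i \<noteq> \<zero>) \<and> (\<Oplus>i\<in>F. c i \<otimes> v i) = \<zero>"
proof (induction Us arbitrary: F v)
  case Nil
  then obtain i where "i \<in> F" by fastforce
  \<comment> \<open>All \<open>v i\<close> are zero here, so coefficients \<open>\<one>\<close> form
    a relation, nontrivial because \<open>\<one>\<close> is nonzero in a subdomain.\<close>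
  have "(\<Oplus>i\<in>F. \<one> \<otimes> v i) = (\<Oplus>i\<in>F. \<zero>)" using Nil by (intro finsum_cong') auto
  thus ?case using \<open>i \<in> F\<close> subdomainE[OF D] by (intro exI[of _ "\<lambda>_. \<one>"]) auto
next
  case (Cons u Us)
  interpret D: subdomain D R by fact
  have Dc: "D \<subseteq> carrier R" and D0: "\<zero> \<in> D" and D1: "\<one> \<in> D" using subdomainE[OF D] by auto
  have Dr: "subring D R" by unfold_locales
  have Us: "set Us \<subseteq> carrier R" using Cons.prems(1) by simp
  have Sc: "Span D Us \<subseteq> carrier R" using Span_subset_carrier[OF Dc Us] .
  have "\<forall>i\<in>F. \<exists>a w. a \<in> D \<and> w \<in> Span D Us \<and> v i = a \<otimes> u \<oplus> w"
    using Cons.prems(4) by (fastforce simp: line_extension_def set_add_def' r_coset_def)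
  then obtain a w where aw: "\<And>i. i \<in> F \<Longrightarrow> a i \<in> D" "\<And>i. i \<in> F \<Longrightarrow> w i \<in> Span D Us"
    "\<And>i. i \<in> F \<Longrightarrow> v i = a i \<otimes> u \<oplus> w i" by metis
  have u: "u \<in> carrier R" using Cons.prems by simp
  have wc: "\<And>i. i \<in> F \<Longrightarrow> w i \<in> carrier R" and ac: "\<And>i. i \<in> F \<Longrightarrow> a i \<in> carrier R" using aw Sc Dc by auto
  hence vc: "\<And>i. i \<in> F \<Longrightarrow> v i \<in> carrier R" using aw u by auto
  show ?case
  proof (cases "\<exists>j\<in>F. a j \<noteq> \<zero>")
    case False
    hence "\<And>i. i \<in> F \<Longrightarrow> v i \<in> Span D Us" using aw u wc by (simp del: Span.simps)
    thus ?thesis using Cons.prems(2,3) Us by (intro Cons.IH) auto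
  next
    case True
    then obtain j where j: "j \<in> F" "a j \<noteq> \<zero>" by blast
    define F' where "F' = F - {j}"
    have F: "F = insert j F'" "j \<notin> F'" "finite F'" using j Cons.prems(2) F'_def by auto
    have card: "length Us < card F'" using Cons.prems(2,3) j F'_def by simp
    \<comment> \<open>The multiples of \<open>u\<close> cancel because \<open>D\<close> is
      commutative.\<close>
    have diff: "a j \<otimes> v i \<ominus> a i \<otimes> v j = a j \<otimes> w i \<ominus> a i \<otimes> w j" if "i \<in> F" for i
    proof -
      have "a j \<otimes> (a i \<otimes> u) = a i \<otimes> (a j \<otimes> u)"
        using that j ac u D.sub_m_comm[OF aw(1)[OF that] aw(1)[OF j(1)]] by (simp add: m_assoc[symmetric])
      hence "a j \<otimes> v i \<ominus> a i \<otimes> v j = (a i \<otimes> (a j \<otimes> u) \<oplus> a j \<otimes> w i) \<ominus> (a i \<otimes> (a j \<otimes> u) \<oplus> a i \<otimes> w j)"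
        using that j ac u wc aw(3) by (simp add: r_distr)
      thus ?thesis using that j ac u wc by (simp add: diff_add_left)
    qed
    have "a j \<otimes> v i \<ominus> a i \<otimes> v j \<in> Span D Us" if i: "i \<in> F'" for i
    proof -
      have "i \<in> F" using i F by simp
      hence "a j \<otimes> v i \<ominus> a i \<otimes> v j = a j \<otimes> w i \<oplus> (\<ominus> a i) \<otimes> w j"
        using diff ac wc j by (simp add: minus_eq l_minus)
      thus ?thesis using aw \<open>i \<in> F\<close> j subringE(5)[OF Dr]
        by (simp del: Span.simps add: Span_subring_add_closed[OF Dr Us] Span_subring_smult_closed[OF Dr _ Us])
    qed
    then obtain c where c: "\<And>i. i \<in> F' \<Longrightarrow> c i \<in> D" "\<exists>i\<in>F'. c i \<noteq> \<zero>"
      "(\<Oplus>i\<in>F'. c i \<otimes> (a j \<otimes> v i \<ominus> a i \<otimes> v j)) = \<zero>"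
      using Cons.IH[OF Us F(3) card, of "\<lambda>i. a j \<otimes> v i \<ominus> a i \<otimes> v j"] by blast
    have cc: "\<And>i. i \<in> F' \<Longrightarrow> c i \<in> carrier R" using c Dc by auto
    \<comment> \<open>Expanding the relation between the differences gives \<open>v j\<close> the
      coefficient \<open>\<ominus> s\<close> and every other \<open>v i\<close> the coefficient
      \<open>c i \<otimes> a j\<close>.\<close>
    define s where "s = (\<Oplus>i\<in>F'. c i \<otimes> a i)"
    define c' where "c' = (\<lambda>i. if i = j then \<ominus> s else c i \<otimes> a j)"
    have sD: "s \<in> D" unfolding s_def
      using F aw c subringE(6)[OF Dr] by (intro finsum_in_subring[OF Dr]) auto
    have sc: "s \<in> carrier R" using sD Dc by auto
    have "(\<Oplus>i\<in>F. c' i \<otimes> v i) = c' j \<otimes> v j \<oplus> (\<Oplus>i\<in>F'. c' i \<otimes> v i)"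
      unfolding F(1) using F ac vc cc sc j by (intro finsum_insert) (auto simp: c'_def)
    also have "(\<Oplus>i\<in>F'. c' i \<otimes> v i) = (\<Oplus>i\<in>F'. c i \<otimes> (a j \<otimes> v i))"
      using F ac vc cc j by (intro finsum_cong') (auto simp: c'_def m_assoc)
    also have "c' j \<otimes> v j = s \<otimes> (\<ominus> v j)" using sc vc j by (simp add: c'_def l_minus r_minus)
    also have "\<dots> = (\<Oplus>i\<in>F'. (c i \<otimes> a i) \<otimes> (\<ominus> v j))"
      unfolding s_def using F ac vc cc j by (intro finsum_ldistr) auto
    also have "\<dots> \<oplus> (\<Oplus>i\<in>F'. c i \<otimes> (a j \<otimes> v i)) =
        (\<Oplus>i\<in>F'. (c i \<otimes> a i) \<otimes> (\<ominus> v j) \<oplus> c i \<otimes> (a j \<otimes> v i))"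
      using F ac vc cc j by (intro finsum_addf[symmetric]) auto
    also have "\<dots> = (\<Oplus>i\<in>F'. c i \<otimes> (a j \<otimes> v i \<ominus> a i \<otimes> v j))"
      using F ac vc cc j
      by (intro finsum_cong') (auto simp: minus_eq r_distr m_assoc r_minus l_minus a_comm)
    finally have "(\<Oplus>i\<in>F. c' i \<otimes> v i) = \<zero>" using c(3) by simp
    moreover have "\<exists>i\<in>F. c' i \<noteq> \<zero>"
    proof -
      obtain i where i: "i \<in> F'" "c i \<noteq> \<zero>" using c(2) by blast
      hence "c i \<otimes> a j \<noteq> \<zero>" using D.subintegral[OF c(1) aw(1)[OF j(1)]] j(2) by blast
      thus ?thesis using i(1) F(1,2) unfolding c'_def by (intro bexI[of _ i]) auto
    qed
    moreover have "\<forall>i\<in>F. c' i \<in> D"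
      using c(1) sD aw j F subringE(5,6)[OF Dr] unfolding c'_def by auto
    ultimately show ?thesis by blast
  qed
qed

subsection \<open>Integral elements of a maximal order\<close>

text \<open>\<open>#>\<close> is the multiplicative coset, so \<open>H #> a\<close> is the image of
  \<open>H\<close> under the additive map of right multiplication by \<open>a\<close>.\<close>

lemma subgroup_r_coset:
  assumes H: "subgroup H (add_monoid R)" and a: "a \<in> carrier R"
  shows "subgroup (H #> a) (add_monoid R)"
proof (rule add.subgroupI)
  have Hc: "H \<subseteq> carrier R" using subgroup.subset[OF H] by simp
  thus "H #> a \<subseteq> carrier R" using a by (auto simp: r_coset_def)
  show "H #> a \<noteq> {}" using subgroup.one_closed[OF H] by (auto simp: r_coset_def)
  fix x y assume "x \<in> H #> a" "y \<in> H #> a"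
  then obtain h k where h: "h \<in> H" "k \<in> H" "x = h \<otimes> a" "y = k \<otimes> a" by (auto simp: r_coset_def)
  have hc: "h \<in> carrier R" "k \<in> carrier R" using h Hc by auto
  have "\<ominus> h \<in> H" using subgroup.m_inv_closed[OF H h(1)] by (simp add: a_inv_def)
  moreover have "\<ominus> x = \<ominus> h \<otimes> a" using h hc a by (simp add: l_minus)
  ultimately show "\<ominus> x \<in> H #> a" unfolding r_coset_def by blast
  have "h \<oplus> k \<in> H" using subgroup.m_closed[OF H h(1,2)] by simp
  moreover have "x \<oplus> y = (h \<oplus> k) \<otimes> a" using h hc a by (simp add: l_distr)
  ultimately show "x \<oplus> y \<in> H #> a" unfolding r_coset_def by blast
qed

lemma Span_append_eq_set_add:
  assumes "D \<subseteq> carrier R" "set Us \<subseteq> carrier R" "set Vs \<subseteq> carrier R"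
  shows "Span D (Us @ Vs) = Span D Us <+>\<^bsub>R\<^esub> Span D Vs"
  using assms(2)
proof (induction Us)
  case Nil
  have "{\<zero>} <+>\<^bsub>R\<^esub> Span D Vs = (\<lambda>x. \<zero> \<oplus> x) ` Span D Vs" unfolding set_add_def' by auto
  also have "\<dots> = (\<lambda>x. x) ` Span D Vs"
    using Span_subset_carrier[OF assms(1,3)] by (intro image_cong refl l_zero) blast
  finally show ?case by simp
next
  case (Cons u Us)
  have "(D #> u) <+>\<^bsub>R\<^esub> (Span D Us <+>\<^bsub>R\<^esub> Span D Vs) = (D #> u) <+>\<^bsub>R\<^esub> Span D Us <+>\<^bsub>R\<^esub> Span D Vs"
    using Span_subset_carrier[OF assms(1)] assms(1,3) Cons.prems unfolding set_add_def
    by (intro add.set_mult_assoc[symmetric]) (auto simp: r_coset_def)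
  thus ?case using Cons by (simp add: line_extension_def)
qed

lemma Span_r_coset:
  assumes "D \<subseteq> carrier R" "set Us \<subseteq> carrier R" "a \<in> carrier R"
  shows "Span D (map (\<lambda>u. u \<otimes> a) Us) = Span D Us #> a"
  using assms(2)
proof (induction Us)
  case Nil thus ?case using assms(3) by (simp add: r_coset_def)
next
  case (Cons u Us)
  have *: "(d \<otimes> (u \<otimes> a)) \<oplus> v \<otimes> a = (d \<otimes> u \<oplus> v) \<otimes> a" if "d \<in> D" "v \<in> Span D Us" for d v
  proof -
    have "d \<in> carrier R" "v \<in> carrier R"
      using that assms(1) Span_subset_carrier[OF assms(1)] Cons.prems by auto
    thus ?thesis using Cons.prems assms(3) by (simp add: l_distr m_assoc)
  qed
  have "Span D (map (\<lambda>u. u \<otimes> a) (u # Us)) = (\<Union>d\<in>D. \<Union>v\<in>Span D Us. {(d \<otimes> (u \<otimes> a)) \<oplus> v \<otimes> a})"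
    using Cons by (simp add: line_extension_def set_add_def' r_coset_def)
  also have "\<dots> = (\<Union>d\<in>D. \<Union>v\<in>Span D Us. {(d \<otimes> u \<oplus> v) \<otimes> a})" by (intro SUP_cong refl) (simp only: *)
  also have "\<dots> = Span D (u # Us) #> a"
    by (simp add: line_extension_def set_add_def' r_coset_def)
  finally show ?case .
qed

text \<open>The left \<open>M\<close>-module generated by the powers of \<open>c\<close> with
  exponent below \<open>n\<close>. The recursion splits off the highest power first, as
  \<open>eval\<close> does with a coefficient list.\<close>

fun power_span :: "'a set \<Rightarrow> 'a \<Rightarrow> nat \<Rightarrow> 'a set" where
  "power_span M c 0 = {\<zero>}"
| "power_span M c (Suc n) = (M #> (c [^] n)) <+>\<^bsub>R\<^esub> power_span M c n"

lemma power_span_Suc_iff: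
  "x \<in> power_span M c (Suc n) \<longleftrightarrow> (\<exists>m\<in>M. \<exists>y\<in>power_span M c n. x = m \<otimes> c [^] n \<oplus> y)"
  by (auto simp: set_add_def' r_coset_def)

declare power_span.simps(2) [simp del]

lemma eval_in_power_span: "set p \<subseteq> M \<Longrightarrow> eval p c \<in> power_span M c (length p)"
  by (induction p) (auto simp: power_span_Suc_iff)

lemma power_span_subgroup:
  assumes "subgroup M (add_monoid R)" "c \<in> carrier R"
  shows "subgroup (power_span M c n) (add_monoid R)"
proof (induction n)
  case 0
  show ?case by (rule add.subgroupI) auto
next
  case (Suc n)
  thus ?case using add_additive_subgroups[OF _ , of "M #> (c [^] n)" "power_span M c n"]
    subgroup_r_coset[OF assms(1), of "c [^] n"] assms(2)
    unfolding power_span.simps additive_subgroup_def by simp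
qed

lemma power_span_mono:
  assumes M: "subring M R" and c: "c \<in> carrier R" and "n \<le> k"
  shows "power_span M c n \<subseteq> power_span M c k"
  using \<open>n \<le> k\<close>
proof (induction k rule: dec_induct)
  case (step k)
  have "x \<in> power_span M c (Suc k)" if "x \<in> power_span M c k" for x
  proof -
    have "x \<in> carrier R"
      using that subgroup.subset[OF power_span_subgroup[OF subring.axioms(1)[OF M] c]] by auto
    hence "x = \<zero> \<otimes> c [^] k \<oplus> x" using c by simp
    thus ?thesis using that subringE(2)[OF M] unfolding power_span_Suc_iff by blast
  qed
  thus ?case using step by blast
qed simp

lemma power_span_l_mult:
  assumes M: "subring M R" and c: "c \<in> carrier R" and m: "m \<in> M"
  shows "x \<in> power_span M c n \<Longrightarrow> m \<otimes> x \<in> power_span M c n"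
proof (induction n arbitrary: x)
  case 0 thus ?case using m subringE(1)[OF M] by auto
next
  case (Suc n)
  then obtain k y where k: "k \<in> M" "y \<in> power_span M c n" "x = k \<otimes> c [^] n \<oplus> y"
    unfolding power_span_Suc_iff by blast
  have "y \<in> carrier R"
    using k subgroup.subset[OF power_span_subgroup[OF subring.axioms(1)[OF M] c]] by auto
  moreover have "m \<in> carrier R" "k \<in> carrier R" using m k subringE(1)[OF M] by auto
  ultimately have "m \<otimes> x = (m \<otimes> k) \<otimes> c [^] n \<oplus> m \<otimes> y" using c k by (simp add: r_distr m_assoc)
  thus ?case using Suc.IH[OF k(2)] subringE(6)[OF M m k(1)] unfolding power_span_Suc_iff by blast
qed

lemma power_span_mult_base:
  assumes M: "subring M R" and c: "c \<in> centre R"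
  shows "x \<in> power_span M c n \<Longrightarrow> c \<otimes> x \<in> power_span M c (Suc n)"
proof (induction n arbitrary: x)
  case 0
  thus ?case using c subringE(2)[OF M] unfolding power_span_Suc_iff centre_def
    by (intro bexI[of _ \<zero>]) auto
next
  case (Suc n)
  have cc: "c \<in> carrier R" using c by (simp add: centre_def)
  obtain k y where k: "k \<in> M" "y \<in> power_span M c n" "x = k \<otimes> c [^] n \<oplus> y"
    using Suc.prems unfolding power_span_Suc_iff by blast
  have y: "y \<in> carrier R"
    using k subgroup.subset[OF power_span_subgroup[OF subring.axioms(1)[OF M] cc]] by auto
  have kc: "k \<in> carrier R" using k subringE(1)[OF M] by auto
  have "c \<otimes> (k \<otimes> c [^] n) = (k \<otimes> c [^] n) \<otimes> c" using c cc kc unfolding centre_def by simp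
  hence "c \<otimes> x = k \<otimes> c [^] Suc n \<oplus> c \<otimes> y" using cc k(3) kc y by (simp add: r_distr m_assoc)
  thus ?case using Suc.IH[OF k(2)] k(1) power_span_Suc_iff[of _ _ _ "Suc n"] by blast
qed

text \<open>The condition on \<open>c [^] n\<close> makes the module stable under \<open>c\<close>,
  hence under all powers of \<open>c\<close> and their combinations over \<open>M\<close>. For
  \<open>k = n\<close> this is closure under multiplication, which makes the module a ring.\<close>

lemma power_span_stable:
  assumes M: "subring M R" and c: "c \<in> centre R" and cn: "c [^] n \<in> power_span M c n"
    and y: "y \<in> power_span M c n"
  shows "x \<in> power_span M c k \<Longrightarrow> x \<otimes> y \<in> power_span M c n"
proof -
  have cc: "c \<in> carrier R" using c by (simp add: centre_def)
  note sub = power_span_subgroup[OF subring.axioms(1)[OF M] cc]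
  have carr: "power_span M c k \<subseteq> carrier R" for k using subgroup.subset[OF sub] by auto
  have add: "a \<oplus> b \<in> power_span M c n" if "a \<in> power_span M c n" "b \<in> power_span M c n" for a b
    using subgroup.m_closed[OF sub that] by simp
  have "power_span M c (Suc n) \<subseteq> power_span M c n"
  proof
    fix x assume "x \<in> power_span M c (Suc n)"
    then show "x \<in> power_span M c n" unfolding power_span_Suc_iff
      using add power_span_l_mult[OF M cc _ cn] by blast
  qed
  hence cy: "c \<otimes> y \<in> power_span M c n" if "y \<in> power_span M c n" for y
    using power_span_mult_base[OF M c that] by blast
  have cky: "c [^] k \<otimes> y \<in> power_span M c n" for k :: nat
  proof (induction k)
    case 0 thus ?case using y carr[of n] by (auto simp: subset_iff)
  next
    case (Suc k)
    have "y \<in> carrier R" using y carr by blast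
    hence "c [^] Suc k \<otimes> y = c [^] k \<otimes> (c \<otimes> y)" using cc by (simp add: m_assoc)
    also have "\<dots> = c \<otimes> (c [^] k \<otimes> y)"
    proof -
      have "c [^] k \<otimes> c = c \<otimes> c [^] k" using c cc unfolding centre_def by simp
      thus ?thesis using cc \<open>y \<in> carrier R\<close> by (simp add: m_assoc[symmetric])
    qed
    finally show ?case using cy[OF Suc] by simp
  qed
  show "x \<in> power_span M c k \<Longrightarrow> x \<otimes> y \<in> power_span M c n"
  proof (induction k arbitrary: x)
    case 0
    moreover have "y \<in> carrier R" using y carr by blast
    ultimately show ?case using subgroup.one_closed[OF sub] by simp
  next
    case (Suc k)
    then obtain m z where k: "m \<in> M" "z \<in> power_span M c k" "x = m \<otimes> c [^] k \<oplus> z"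
      unfolding power_span_Suc_iff by blast
    have "z \<in> carrier R" "y \<in> carrier R" "m \<in> carrier R" using k y carr subringE(1)[OF M] by auto
    hence "x \<otimes> y = m \<otimes> (c [^] k \<otimes> y) \<oplus> z \<otimes> y" using k cc by (simp add: l_distr m_assoc)
    thus ?case using add power_span_l_mult[OF M cc k(1) cky] Suc.IH[OF k(2)] by simp
  qed
qed

text \<open>The products of the generators of \<open>M\<close> with the powers of \<open>c\<close>
  generate. This provides the finite generation that an order requires.\<close>

lemma power_span_eq_Span:
  assumes M: "subring M R" and c: "c \<in> carrier R" and D: "D \<subseteq> carrier R"
    and Us: "set Us \<subseteq> M" "Span D Us = M"
  shows "\<exists>Vs. set Vs \<subseteq> power_span M c n \<and> Span D Vs = power_span M c n"
proof (induction n)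
  case 0 show ?case by (intro exI[of _ "[]"]) simp
next
  case (Suc n)
  then obtain Vs where Vs: "set Vs \<subseteq> power_span M c n" "Span D Vs = power_span M c n" by blast
  note sub = power_span_subgroup[OF subring.axioms(1)[OF M] c]
  have carr: "power_span M c k \<subseteq> carrier R" for k using subgroup.subset[OF sub] by auto
  let ?Ws = "map (\<lambda>u. u \<otimes> c [^] n) Us @ Vs"
  have "Span D ?Ws = power_span M c (Suc n)"
    using Vs carr[of n] c D Us subringE(1)[OF M]
    by (subst Span_append_eq_set_add) (auto simp del: Span.simps simp: Span_r_coset power_span.simps)
  moreover have "set ?Ws \<subseteq> power_span M c (Suc n)"
  proof
    fix w assume "w \<in> set ?Ws"
    then consider u where "u \<in> M" "w = u \<otimes> c [^] n" | "w \<in> power_span M c n" using Vs Us by auto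
    thus "w \<in> power_span M c (Suc n)"
    proof cases
      case 1
      hence "w = u \<otimes> c [^] n \<oplus> \<zero>" using c subringE(1)[OF M] by auto
      thus ?thesis unfolding power_span_Suc_iff using subgroup.one_closed[OF sub] 1 by auto
    qed (use power_span_mono[OF M c, of n "Suc n"] in auto)
  qed
  ultimately show ?case by blast
qed

lemma range_int_subset_subring:
  assumes "subring M R" shows "range (\<lambda>n::int. add_pow R n \<one>) \<subseteq> M"
  using add.subgroup_int_pow_closed[OF subring.axioms(1)[OF assms]] subringE(3)[OF assms]
  unfolding add_pow_def by auto

text \<open>
  The ring \<open>M[c]\<close> is again an order. Here and below it is not known that the integral elements form a
  ring, so only the \<open>M\<close>-module generated by finitely many powers of \<open>c\<close> is used.
\<close>

lemma maximal_order_integrally_closed: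
  assumes M: "is_maximal_order R K M" and K: "subfield K R"
    and c: "c \<in> centre R" and S: "S \<subseteq> M" and p: "set p \<subseteq> S" "p \<noteq> []" "hd p = \<one>" "eval p c = \<zero>"
  shows "c \<in> M"
proof -
  have ord: "is_order R K M" and max: "\<And>N. is_order R K N \<Longrightarrow> M \<subseteq> N \<Longrightarrow> N = M"
    using M unfolding is_maximal_order_def by auto
  have Mr: "subring M R" using ord unfolding is_order_def by simp
  have cc: "c \<in> carrier R" using c by (simp add: centre_def)
  obtain q where q: "p = \<one> # q" using p(2,3) by (cases p) auto
  define n where "n = length q"
  note sub = power_span_subgroup[OF subring.axioms(1)[OF Mr] cc]
  have carr: "power_span M c k \<subseteq> carrier R" for k using subgroup.subset[OF sub] by auto
  have eq: "eval q c \<in> power_span M c n" unfolding n_def using p q S by (intro eval_in_power_span) auto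
  \<comment> \<open>The monic equation expresses \<open>c [^] n\<close> through lower powers with
    coefficients in \<open>M\<close>.\<close>
  have "c [^] n \<oplus> eval q c = \<zero>" using p(4) cc unfolding q n_def by simp
  hence "c [^] n = \<ominus> eval q c" using cc eq carr by (intro minus_equality[symmetric]) auto
  hence cn: "c [^] n \<in> power_span M c n"
    using subgroup.m_inv_closed[OF sub eq] by (simp add: a_inv_def)
  show "c \<in> M"
  proof (cases "n = 0")
    \<comment> \<open>The constant polynomial \<open>\<one>\<close> then has a root, so the ring is
      zero.\<close>
    case True
    hence "\<one> = \<zero>" using cn by simp
    hence "c = \<zero>" using cc by (metis r_null r_one)
    thus ?thesis using subringE(2)[OF Mr] by simp
  next
    case False
    let ?N = "power_span M c n"
    have "M \<subseteq> power_span M c 1"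
      using subringE(1)[OF Mr] by (force simp: power_span_Suc_iff)
    hence MN: "M \<subseteq> ?N" using power_span_mono[OF Mr cc, of 1 n] False by auto
    have "subring ?N R"
      using subgroup.m_closed[OF sub] subgroup.m_inv_closed[OF sub] carr MN subringE(3)[OF Mr]
        power_span_stable[OF Mr c cn] by (intro subringI) (auto simp: a_inv_def)
    have "ring_of_integers R K \<subseteq> carrier R"
      using subfieldE(3)[OF K] unfolding ring_of_integers_def integral_closure_def by blast
    moreover obtain Us where "set Us \<subseteq> M" "Span (ring_of_integers R K) Us = M"
      using ord unfolding is_order_def by blast
    ultimately have "\<exists>Vs. set Vs \<subseteq> ?N \<and> Span (ring_of_integers R K) Vs = ?N"
      using power_span_eq_Span[OF Mr cc] by blast
    moreover have "full R K ?N" using ord MN unfolding is_order_def full_def by (meson subset_trans)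
    ultimately have "is_order R K ?N" using \<open>subring ?N R\<close> unfolding is_order_def by blast
    \<comment> \<open>Maximality collapses the larger order to \<open>M\<close>. It contains
      \<open>c\<close> because it contains \<open>\<one>\<close> and is stable under
      \<open>c\<close>.\<close>
    hence "?N = M" using max MN by blast
    moreover have "c \<otimes> \<one> \<in> power_span M c (Suc 0 + n)" 
      using power_span_mult_base[OF Mr c, of \<one> n] MN subringE(3)[OF Mr] by auto
    moreover have "power_span M c (Suc n) \<subseteq> ?N"
      using cn power_span_l_mult[OF Mr cc _ cn] subgroup.m_closed[OF sub]
      by (auto simp: power_span_Suc_iff)
    ultimately show ?thesis using cc by auto
  qed
qed

text \<open>Integer multiples of \<open>\<one>\<close> lie in every subring, so the equation of an
  algebraic integer has its coefficients in \<open>M\<close>.\<close>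

lemma ring_of_integers_subset_maximal_order:
  assumes M: "is_maximal_order R K M" and K: "subfield K R" "K \<subseteq> centre R"
  shows "ring_of_integers R K \<subseteq> M"
proof
  fix c assume c: "c \<in> ring_of_integers R K"
  have "subring M R" using M unfolding is_maximal_order_def is_order_def by simp
  moreover obtain p where "c \<in> K" "set p \<subseteq> range (\<lambda>n::int. add_pow R n \<one>)" "p \<noteq> []" "hd p = \<one>" "eval p c = \<zero>"
    using c unfolding ring_of_integers_def integral_closure_def by blast
  ultimately show "c \<in> M"
    using K(2) range_int_subset_subring by (intro maximal_order_integrally_closed[OF M K(1)]) auto
qed

text \<open>A second use of integral closedness: the coefficients now lie in the ring of integers,
  already known to be inside \<open>M\<close>.\<close>

lemma integral_closure_subset_maximal_order:
  assumes M: "is_maximal_order R K M" and K: "subfield K R" "K \<subseteq> centre R"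
  shows "integral_closure R (ring_of_integers R K) (centre R) \<subseteq> M"
proof
  fix c assume "c \<in> integral_closure R (ring_of_integers R K) (centre R)"
  then obtain p where "c \<in> centre R" "set p \<subseteq> ring_of_integers R K" "p \<noteq> []" "hd p = \<one>" "eval p c = \<zero>"
    unfolding integral_closure_def by blast
  thus "c \<in> M"
    using maximal_order_integrally_closed[OF M K(1) _ ring_of_integers_subset_maximal_order[OF assms]] by blast
qed

subsection \<open>Free left ideals\<close>

lemma additive_subgroup_of_subring:
  assumes "subring M R" "additive_subgroup J (R\<lparr>carrier := M\<rparr>)"
  shows "subgroup J (add_monoid R)"
  using add.incl_subgroup[OF subring.axioms(1)[OF assms(1)], of J] additive_subgroup.a_subgroup[OF assms(2)]
  by simp

text \<open>The relation \<open>u \<otimes> x = \<zero>\<close> passes from \<open>J\<close> to its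
  \<open>K\<close>-span, which contains \<open>\<one>\<close>.\<close>

lemma full_left_annihilator:
  assumes K: "K \<subseteq> carrier R" and J: "full R K J" "J \<subseteq> carrier R"
    and x: "x \<in> carrier R" "\<And>u. u \<in> J \<Longrightarrow> u \<otimes> x = \<zero>"
  shows "x = \<zero>"
proof -
  obtain Us where Us: "set Us \<subseteq> J" "Span K Us = carrier R" using J(1) unfolding full_def by blast
  have "y \<otimes> x = \<zero>" if "y \<in> Span K Us" for y
    using that Us(1)
  proof (induction Us arbitrary: y)
    case Nil thus ?case using x(1) by simp
  next
    case (Cons u Us)
    obtain k v where k: "k \<in> K" "v \<in> Span K Us" "y = k \<otimes> u \<oplus> v"
      using Cons.prems(1) by (auto simp: line_extension_def set_add_def' r_coset_def)
    have "v \<in> carrier R" using k(2) Span_subset_carrier[OF K] Cons.prems(2) J(2) by auto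
    moreover have "v \<otimes> x = \<zero>" using Cons.IH[OF k(2)] Cons.prems(2) by simp
    moreover have "u \<otimes> x = \<zero>" "u \<in> carrier R" using x(2) Cons.prems(2) J(2) by auto
    moreover have "k \<in> carrier R" using k K by auto
    ultimately show ?case using x(1) by (simp add: k(3) l_distr m_assoc)
  qed
  from this[of \<one>] show ?thesis using Us(2) x(1) by simp
qed

text \<open>
  Two left independent elements generate arbitrarily long independent sequences, as in the
  classical example of a free submodule of infinite rank inside a free algebra.
\<close>

lemma independent_pair_imp_independent_sequence:
  assumes L: "subring L R" "b \<in> L" "b' \<in> L"
    and indep: "\<And>x y. x \<in> L \<Longrightarrow> y \<in> L \<Longrightarrow> x \<otimes> b \<oplus> y \<otimes> b' = \<zero> \<Longrightarrow> x = \<zero> \<and> y = \<zero>"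
  shows "\<lbrakk>\<And>i. i \<le> (n::nat) \<Longrightarrow> l i \<in> L; (\<Oplus>i\<in>{..n}. l i \<otimes> (b' \<otimes> b [^] i)) = \<zero>; i \<le> n\<rbrakk> \<Longrightarrow> l i = \<zero>"
proof (induction n arbitrary: l i)
  case 0
  have c: "b' \<in> carrier R" "b \<in> carrier R" "l 0 \<in> carrier R" using L subringE(1)[OF L(1)] 0(1)[of 0] by auto
  have "\<zero> \<otimes> b \<oplus> l 0 \<otimes> b' = \<zero>" using 0(2) c by simp
  thus ?case using indep[of \<zero> "l 0"] 0 subringE(2)[OF L(1)] by auto
next
  case (Suc n)
  have c: "b' \<in> carrier R" "b \<in> carrier R" using L subringE(1)[OF L(1)] by auto
  have lc: "\<And>i. i \<le> Suc n \<Longrightarrow> l i \<in> carrier R" using Suc.prems(1) subringE(1)[OF L(1)] by auto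
  have bL: "b [^] i \<in> L" for i :: nat
    using L subringE(3,6)[OF L(1)] by (induction i) auto
  \<comment> \<open>With the term of index zero split off, the relation reads
    \<open>s \<otimes> b \<oplus> l 0 \<otimes> b' = \<zero>\<close>. Hence \<open>l 0\<close>
    vanishes, and \<open>s = \<zero>\<close> is a relation with one term fewer.\<close>
  define s where "s = (\<Oplus>i\<in>{..n}. l (Suc i) \<otimes> (b' \<otimes> b [^] i))"
  have sL: "s \<in> L" unfolding s_def
    using Suc.prems(1) L bL subringE(6)[OF L(1)] by (intro finsum_in_subring) auto
  have "(\<Oplus>i\<in>{..Suc n}. l i \<otimes> (b' \<otimes> b [^] i)) =
      (\<Oplus>i\<in>{..n}. l (Suc i) \<otimes> (b' \<otimes> b [^] Suc i)) \<oplus> l 0 \<otimes> (b' \<otimes> b [^] (0::nat))"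
    using c lc by (intro finsum_Suc2) auto
  also have "(\<Oplus>i\<in>{..n}. l (Suc i) \<otimes> (b' \<otimes> b [^] Suc i)) =
      (\<Oplus>i\<in>{..n}. l (Suc i) \<otimes> (b' \<otimes> b [^] i) \<otimes> b)"
    using c lc by (intro finsum_cong') (auto simp: m_assoc)
  also have "\<dots> = s \<otimes> b"
    unfolding s_def using c lc by (intro finsum_ldistr[symmetric]) auto
  finally have "s \<otimes> b \<oplus> l 0 \<otimes> b' = \<zero>" using Suc.prems(2) c lc[of 0] by simp
  hence "s = \<zero>" "l 0 = \<zero>" using indep[OF sL Suc.prems(1)[of 0]] by auto
  moreover have "l (Suc j) = \<zero>" if "j \<le> n" for j
    using Suc.IH[of "\<lambda>i. l (Suc i)" j] Suc.prems(1) \<open>s = \<zero>\<close> that unfolding s_def by simp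
  ultimately show ?case using Suc.prems(3) by (cases i) auto
qed

text \<open>As \<open>M\<close> has \<open>length Us\<close> generators, one more of the elements
  \<open>b' \<otimes> b [^] i\<close> are dependent over a domain of scalars. The coefficients are
  in \<open>M\<close>, and multiplying them by an element of \<open>f\<close> brings them into
  \<open>L\<close>. Independence over \<open>L\<close> then shows that \<open>f\<close> annihilates
  them, and fullness of \<open>f\<close> makes them zero.\<close>

lemma no_independent_pair:
  assumes K: "subfield K R" and M: "subring M R" "set Us \<subseteq> M" "O' \<subseteq> K" "O' \<subseteq> M" "Span O' Us = M"
    and L: "subring L R" "L \<subseteq> M" and f: "ideal f (R\<lparr>carrier := M\<rparr>)" "full R K f" "f \<subseteq> L"
    and b: "b \<in> L" "b' \<in> L"
    and indep: "\<And>x y. x \<in> L \<Longrightarrow> y \<in> L \<Longrightarrow> x \<otimes> b \<oplus> y \<otimes> b' = \<zero> \<Longrightarrow> x = \<zero> \<and> y = \<zero>"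
  shows False
proof -
  \<comment> \<open>\<open>O'\<close> is not assumed to be a ring; the intersection is a domain that
    contains it.\<close>
  define D where "D = K \<inter> M"
  interpret K: subfield K R by fact
  have D: "subdomain D R" unfolding D_def
    using subring_inter[OF _ M(1)] K.subring_axioms K.sub_m_comm K.subintegral
    by (auto simp: subdomain_def subcring_def subcring_axioms_def subdomain_axioms_def)
  have Mc: "M \<subseteq> carrier R" using subringE(1)[OF M(1)] .
  have "Span O' Us \<subseteq> Span D Us"
  proof (induction Us)
    case (Cons u Us)
    thus ?case using M(3,4) unfolding D_def by (auto simp: line_extension_def set_add_def' r_coset_def)
  qed simp
  hence SD: "M \<subseteq> Span D Us" using M(5) by simp
  define v where "v = (\<lambda>i::nat. b' \<otimes> b [^] i)"
  have bL: "b [^] i \<in> L" for i :: nat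
    using b subringE(3,6)[OF L(1)] by (induction i) auto
  hence vL: "v i \<in> L" for i unfolding v_def using b subringE(6)[OF L(1)] by auto
  hence vc: "v i \<in> carrier R" for i using subringE(1)[OF L(1)] by auto
  have "v i \<in> Span D Us" for i using vL L(2) SD by blast
  hence "\<exists>c. (\<forall>i\<in>{..length Us}. c i \<in> D) \<and> (\<exists>i\<in>{..length Us}. c i \<noteq> \<zero>) \<and>
      (\<Oplus>i\<in>{..length Us}. c i \<otimes> v i) = \<zero>"
    using M(2) Mc by (intro finsum_dependent[OF D, of Us]) auto
  then obtain c where c: "\<And>i. i \<in> {..length Us} \<Longrightarrow> c i \<in> D" "\<exists>i\<in>{..length Us}. c i \<noteq> \<zero>"
    "(\<Oplus>i\<in>{..length Us}. c i \<otimes> v i) = \<zero>" by blast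
  have cM: "\<And>i. i \<le> length Us \<Longrightarrow> c i \<in> M" using c(1) D_def by auto
  hence cc: "\<And>i. i \<le> length Us \<Longrightarrow> c i \<in> carrier R" using Mc by blast
  have "c i = \<zero>" if i: "i \<le> length Us" for i
  proof (rule full_left_annihilator[OF _ f(2)])
    fix u assume u: "u \<in> f"
    have uc: "u \<in> carrier R" using u f(3) L(2) Mc by auto
    have "(\<Oplus>i\<in>{..length Us}. (u \<otimes> c i) \<otimes> v i) = (\<Oplus>i\<in>{..length Us}. u \<otimes> (c i \<otimes> v i))"
      using uc cc vc by (intro finsum_cong') (auto simp: m_assoc)
    also have "\<dots> = u \<otimes> (\<Oplus>i\<in>{..length Us}. c i \<otimes> v i)"
      using uc cc vc by (intro finsum_rdistr[symmetric]) auto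
    finally have "(\<Oplus>i\<in>{..length Us}. (u \<otimes> c i) \<otimes> (b' \<otimes> b [^] i)) = \<zero>"
      using uc c(3) by (simp add: v_def)
    moreover have "u \<otimes> c i \<in> L" if "i \<le> length Us" for i
      using ideal.I_r_closed[OF f(1) u, of "c i"] cM[OF that] f(3) by auto
    ultimately show "u \<otimes> c i = \<zero>"
      using independent_pair_imp_independent_sequence[OF L(1) b indep, where l = "\<lambda>i. u \<otimes> c i"] i by blast
  qed (use cM[OF i] Mc K.subset f(3) L(2) in auto)
  thus False using c(2) by auto
qed

lemma finsum_support:
  assumes "finite F" "{b. c b \<noteq> \<zero>} \<subseteq> F" "F \<subseteq> carrier R" "\<And>b. c b \<in> carrier R"
  shows "finsum R (\<lambda>b. c b \<otimes> b) {b. c b \<noteq> \<zero>} = finsum R (\<lambda>b. c b \<otimes> b) F"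
  using assms by (intro add.finprod_mono_neutral_cong_left) auto

text \<open>Zero has only one representation, so two distinct basis elements would be independent,
  against \<open>rank\<close>, while an empty basis would force \<open>N = {\<zero>}\<close>. The
  basis is thus a singleton, and uniqueness for zero also shows that nothing nonzero in
  \<open>L\<close> annihilates it.\<close>

lemma free_left_module_imp_cyclic:
  assumes free: "free_left_module R L N" and L: "subring L R"
    and N: "N \<subseteq> carrier R" "N \<noteq> {\<zero>}" "N \<noteq> {}" "\<And>l x. l \<in> L \<Longrightarrow> x \<in> N \<Longrightarrow> l \<otimes> x \<in> N"
    and rank: "\<And>b b'. b \<in> N \<Longrightarrow> b' \<in> N \<Longrightarrow>
      (\<And>x y. x \<in> L \<Longrightarrow> y \<in> L \<Longrightarrow> x \<otimes> b \<oplus> y \<otimes> b' = \<zero> \<Longrightarrow> x = \<zero> \<and> y = \<zero>) \<Longrightarrow> False"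
  shows "\<exists>a\<in>N. N = L #> a \<and> (\<forall>l\<in>L. l \<otimes> a = \<zero> \<longrightarrow> l = \<zero>)"
proof -
  define rep where "rep = (\<lambda>B x c. (\<forall>b\<in>B. c b \<in> L) \<and> (\<forall>b. b \<notin> B \<longrightarrow> c b = \<zero>) \<and> finite {b. c b \<noteq> \<zero>} \<and>
        x = finsum R (\<lambda>b. c b \<otimes> b) {b. c b \<noteq> \<zero>})"
  have "\<exists>B\<subseteq>N. \<forall>x\<in>N. \<exists>!c. rep B x c"
    using free unfolding free_left_module_def rep_def .
  then obtain B where B: "B \<subseteq> N" "\<And>x. x \<in> N \<Longrightarrow> \<exists>!c. rep B x c"
    by (elim exE conjE) (simp only: Ball_def)
  have Lc: "L \<subseteq> carrier R" and L0: "\<zero> \<in> L" using subringE[OF L] by auto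
  have "\<zero> \<in> N" using N(1,3) N(4)[OF L0] l_null by (metis equals0I subsetD)
  hence zero: "c b = \<zero>" if "rep B \<zero> c" for c b
  proof -
    have "rep B \<zero> (\<lambda>_. \<zero>)" using L0 by (simp add: rep_def)
    hence "c = (\<lambda>_. \<zero>)" using B(2)[OF \<open>\<zero> \<in> N\<close>] that by blast
    thus ?thesis by simp
  qed
  have "b = b'" if b: "b \<in> B" "b' \<in> B" for b b'
  proof (rule ccontr)
    assume ne: "b \<noteq> b'"
    have bc: "b \<in> carrier R" "b' \<in> carrier R" using b B(1) N(1) by auto
    have "x = \<zero> \<and> y = \<zero>" if xy: "x \<in> L" "y \<in> L" "x \<otimes> b \<oplus> y \<otimes> b' = \<zero>" for x y
    proof -
      define c where "c = (\<lambda>_. \<zero>)(b := x, b' := y)"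
      have xyc: "x \<in> carrier R" "y \<in> carrier R" using xy Lc by auto
      have supp: "{b. c b \<noteq> \<zero>} \<subseteq> {b, b'}" unfolding c_def by auto
      have "finsum R (\<lambda>b. c b \<otimes> b) {b. c b \<noteq> \<zero>} = finsum R (\<lambda>b. c b \<otimes> b) {b, b'}"
        using bc xyc by (intro finsum_support supp) (auto simp: c_def)
      also have "\<dots> = \<zero>" using bc xyc xy ne by (simp add: c_def)
      finally have "rep B \<zero> c"
        using finite_subset[OF supp] xy b L0 by (auto simp: rep_def c_def)
      thus ?thesis using zero[of c b] zero[of c b'] ne unfolding c_def by simp
    qed
    thus False using rank[of b b'] b B(1) by blast
  qed
  moreover have "B \<noteq> {}"
  proof
    assume "B = {}"
    have "x = \<zero>" if x: "x \<in> N" for x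
    proof -
      obtain c where c: "rep B x c" using B(2)[OF x] by blast
      hence "{b. c b \<noteq> \<zero>} = {}" using \<open>B = {}\<close> by (simp add: rep_def)
      thus ?thesis using c by (simp add: rep_def)
    qed
    thus False using N(2,3) by blast
  qed
  ultimately obtain a where a: "B = {a}" by blast
  have aN: "a \<in> N" and ac: "a \<in> carrier R" using a B(1) N(1) by auto
  have single: "finsum R (\<lambda>b. c b \<otimes> b) {b. c b \<noteq> \<zero>} = c a \<otimes> a"
    if c: "c a \<in> L" "\<forall>b. b \<notin> B \<longrightarrow> c b = \<zero>" for c
  proof -
    have cc: "c b \<in> carrier R" for b using c a Lc by (cases "b = a") auto
    have "finsum R (\<lambda>b. c b \<otimes> b) {b. c b \<noteq> \<zero>} = finsum R (\<lambda>b. c b \<otimes> b) {a}"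
      using c a ac cc by (intro finsum_support) auto
    thus ?thesis using ac cc by simp
  qed
  have "N \<subseteq> L #> a"
  proof
    fix x assume "x \<in> N"
    then obtain c where "rep B x c" using B(2) by blast
    hence "c a \<in> L" "x = c a \<otimes> a" using single[of c] a unfolding rep_def by auto
    thus "x \<in> L #> a" unfolding r_coset_def by blast
  qed
  moreover have "L #> a \<subseteq> N" using N(4) aN unfolding r_coset_def by auto
  moreover have "l = \<zero>" if l: "l \<in> L" "l \<otimes> a = \<zero>" for l
  proof -
    define c where "c = (\<lambda>_. \<zero>)(a := l)"
    have "{b. c b \<noteq> \<zero>} \<subseteq> {a}" unfolding c_def by auto
    hence "finite {b. c b \<noteq> \<zero>}" by (rule finite_subset) simp
    hence "rep B \<zero> c" using single[of c] l a by (auto simp: rep_def c_def)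
    thus ?thesis using zero[of c a] by (simp add: c_def)
  qed
  ultimately show ?thesis using aN by blast
qed

lemma cyclic_imp_free_left_module:
  assumes L: "L \<subseteq> carrier R" "\<zero> \<in> L" "\<one> \<in> L" and a: "a \<in> carrier R" "\<And>l. l \<in> carrier R \<Longrightarrow> l \<otimes> a = \<zero> \<Longrightarrow> l = \<zero>"
  shows "free_left_module R L (L #> a)"
  unfolding free_left_module_def
proof (intro exI[of _ "{a}"] conjI ballI)
  show "{a} \<subseteq> L #> a" using L(3) a(1) by (force simp: r_coset_def)
  fix x assume "x \<in> L #> a"
  then obtain l where l: "l \<in> L" "x = l \<otimes> a" by (auto simp: r_coset_def)
  have single: "finsum R (\<lambda>b. c b \<otimes> b) {b. c b \<noteq> \<zero>} = c a \<otimes> a"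
    if c: "c a \<in> L" "\<forall>b. b \<notin> {a} \<longrightarrow> c b = \<zero>" for c
  proof -
    have cc: "c b \<in> carrier R" for b using c L by (cases "b = a") auto
    have "finsum R (\<lambda>b. c b \<otimes> b) {b. c b \<noteq> \<zero>} = finsum R (\<lambda>b. c b \<otimes> b) {a}"
      using c a cc by (intro finsum_support) auto
    thus ?thesis using a cc by simp
  qed
  let ?rep = "\<lambda>c. (\<forall>b\<in>{a}. c b \<in> L) \<and> (\<forall>b. b \<notin> {a} \<longrightarrow> c b = \<zero>) \<and> finite {b. c b \<noteq> \<zero>} \<and>
        x = finsum R (\<lambda>b. c b \<otimes> b) {b. c b \<noteq> \<zero>}"
  define c0 where "c0 = (\<lambda>_. \<zero>)(a := l)"
  show "\<exists>!c. ?rep c"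
  proof (rule ex1I[of _ c0])
    have "{b. c0 b \<noteq> \<zero>} \<subseteq> {a}" unfolding c0_def by auto
    hence "finite {b. c0 b \<noteq> \<zero>}" by (rule finite_subset) simp
    thus "?rep c0" using single[of c0] l by (auto simp: c0_def)
  next
    fix c assume c: "?rep c"
    hence eq: "c a \<otimes> a = l \<otimes> a" using single[of c] l by simp
    have carr: "c a \<in> carrier R" "l \<in> carrier R" using c l L(1) by auto
    have "(c a \<ominus> l) \<otimes> a = c a \<otimes> a \<ominus> l \<otimes> a" using carr a(1) by (simp add: minus_eq l_distr l_minus)
    also have "\<dots> = \<zero>" unfolding eq using carr a(1) by (simp add: minus_eq r_neg)
    finally have "c a \<ominus> l = \<zero>" using a(2) carr by simp
    hence "c a = l" using carr by simp
    thus "c = c0" using c unfolding c0_def by auto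
  qed
qed

subsection \<open>Left ideals that are comaximal with a two-sided ideal\<close>

text \<open>
  An element of \<open>(M #> b) \<inter> L\<close> is congruent modulo \<open>I\<close> to some \<open>n \<otimes> b\<close> in \<open>f\<close>. As \<open>b\<close> is invertible
  modulo \<open>f\<close>, already \<open>n\<close> is in \<open>f\<close>, so that \<open>n \<otimes> b\<close> lies in \<open>f \<cdot> (M \<cdot> I) \<subseteq> L \<cdot> I\<close>.
\<close>

lemma left_ideal_eq_inter_extension:
  assumes M: "subring M R" and L: "subring L R" "L \<subseteq> M" and f: "ideal f (R\<lparr>carrier := M\<rparr>)" "f \<subseteq> L"
    and I: "left_ideal I (R\<lparr>carrier := L\<rparr>)" "I <+>\<^bsub>R\<^esub> f = L"
    and b: "b \<in> M" "M \<cdot> I = M #> b" and c: "c \<in> M" "b \<otimes> c \<in> f +> \<one>"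
  shows "I = (M #> b) \<inter> L"
proof
  have Mc: "M \<subseteq> carrier R" and M1: "\<one> \<in> M" using subringE[OF M] by auto
  have I': "subgroup I (add_monoid R)" "I \<subseteq> L" "\<And>l x. l \<in> L \<Longrightarrow> x \<in> I \<Longrightarrow> l \<otimes> x \<in> I"
    using I(1) additive_subgroup_of_subring[OF L(1)] additive_subgroup.a_subset[of I "R\<lparr>carrier := L\<rparr>"]
    unfolding left_ideal_def by auto
  have f': "subgroup f (add_monoid R)"
    using additive_subgroup_of_subring[OF M ideal.axioms(1)[OF f(1)]] .
  have fl: "\<And>x m. x \<in> f \<Longrightarrow> m \<in> M \<Longrightarrow> m \<otimes> x \<in> f" and fr: "\<And>x m. x \<in> f \<Longrightarrow> m \<in> M \<Longrightarrow> x \<otimes> m \<in> f"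
    using ideal.I_l_closed[OF f(1)] ideal.I_r_closed[OF f(1)] by auto
  show "I \<subseteq> (M #> b) \<inter> L"
  proof
    fix x assume x: "x \<in> I"
    have "\<one> \<otimes> x \<in> M \<cdot> I" using x M1 by (rule ideal_prod.prod[rotated])
    moreover have "x \<in> L" "x \<in> carrier R" using x I'(2) L(2) Mc by auto
    ultimately show "x \<in> (M #> b) \<inter> L" using b(2) by simp
  qed
  show "(M #> b) \<inter> L \<subseteq> I"
  proof
    fix y assume y: "y \<in> (M #> b) \<inter> L"
    then obtain x p where xp: "x \<in> I" "p \<in> f" "y = x \<oplus> p" using I(2) unfolding set_add_def' by auto
    have "\<one> \<otimes> x \<in> M \<cdot> I" using xp(1) M1 by (rule ideal_prod.prod[rotated])
    moreover have "x \<in> carrier R" using xp(1) I'(2) L(2) Mc by auto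
    ultimately have "x \<in> M #> b" using b(2) by simp
    then obtain m m' where m: "m \<in> M" "m' \<in> M" "y = m \<otimes> b" "x = m' \<otimes> b"
      using y unfolding r_coset_def by auto
    define n where "n = m \<ominus> m'"
    have n: "n \<in> M" unfolding n_def minus_eq using m subringE(5,7)[OF M] by simp
    have carr: "x \<in> carrier R" "p \<in> carrier R" "y \<in> carrier R" "b \<in> carrier R" "c \<in> carrier R"
      "m \<in> carrier R" "m' \<in> carrier R" "n \<in> carrier R"
      using xp y m n b c f(2) I'(2) L(2) Mc by auto
    have "p = y \<ominus> x" unfolding xp(3) using carr(1,2) by algebra
    also have "\<dots> = n \<otimes> b" using carr m unfolding n_def by (simp add: minus_eq l_distr l_minus)
    finally have p: "p = n \<otimes> b" .
    obtain j where j: "j \<in> f" "b \<otimes> c = j \<oplus> \<one>" using c(2) unfolding a_r_coset_def' by auto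
    have jc: "j \<in> carrier R" using j f(2) L(2) Mc by auto
    \<comment> \<open>Multiplication by the inverse \<open>c\<close> of \<open>b\<close> modulo
      \<open>f\<close> recovers \<open>n\<close> from \<open>p\<close> up to an element of
      \<open>f\<close>, and \<open>p\<close> itself is in \<open>f\<close>.\<close>
    have "p \<otimes> c = n \<otimes> j \<oplus> n" using carr jc p j(2) by (simp add: m_assoc r_distr)
    hence "n = \<ominus> (n \<otimes> j) \<oplus> p \<otimes> c" using carr jc by (simp add: r_neg1)
    also have "\<dots> \<in> f"
      using subgroup.m_closed[OF f' subgroup.m_inv_closed[OF f' fl[OF j(1) n]] fr[OF xp(2) c(1)]]
      by (simp add: a_inv_def)
    finally have nf: "n \<in> f" .
    \<comment> \<open>An element of \<open>f\<close> carries \<open>M\<close> into \<open>f\<close>,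
      hence into \<open>L\<close>, and \<open>I\<close> is stable under \<open>L\<close>.\<close>
    have fMI: "n \<otimes> z \<in> I" if "z \<in> M \<cdot> I" for z
      using that
    proof (induction z rule: ideal_prod.induct)
      case (prod i j)
      have "n \<otimes> (i \<otimes> j) = (n \<otimes> i) \<otimes> j" using carr prod I'(2) L(2) Mc by (simp add: m_assoc subset_iff)
      thus ?case using I'(3) fr[OF nf prod(1)] f(2) prod(2) by auto
    next
      case (sum s t)
      have MI: "z \<in> carrier R" if "z \<in> M \<cdot> I" for z
        using that b(2) carr Mc by (auto simp: r_coset_def)
      have "n \<otimes> (s \<oplus> t) = n \<otimes> s \<oplus> n \<otimes> t" using carr MI sum by (simp add: r_distr)
      thus ?case using subgroup.m_closed[OF I'(1) sum(3,4)] by simp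
    qed
    have "\<one> \<otimes> b \<in> M #> b" using M1 unfolding r_coset_def by blast
    hence "p \<in> I" using fMI[of b] b(2) carr p by simp
    thus "y \<in> I" using xp subgroup.m_closed[OF I'(1), of x p] by simp
  qed
qed

section \<open>Cosets and units modulo an ideal\<close>

lemma rcoset_eq_iff:
  assumes "ideal J R" "x \<in> carrier R" "y \<in> carrier R"
  shows "J +> x = J +> y \<longleftrightarrow> x \<in> J +> y"
  using a_repr_independence[of x J y] additive_subgroup.a_subgroup[OF ideal.axioms(1)[OF assms(1)]]
    abelian_subgroup.a_rcos_self[OF abelian_subgroupI3[OF ideal.axioms(1)[OF assms(1)] is_abelian_group]] assms
  by auto

lemma Units_Quot_iff:
  assumes J: "ideal J R" and x: "x \<in> carrier R"
  shows "J +> x \<in> Units (R Quot J) \<longleftrightarrow> (\<exists>y\<in>carrier R. x \<otimes> y \<in> J +> \<one> \<and> y \<otimes> x \<in> J +> \<one>)"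
proof -
  have "J +> x \<in> Units (R Quot J) \<longleftrightarrow>
      (\<exists>y\<in>carrier R. J +> (x \<otimes> y) = J +> \<one> \<and> J +> (y \<otimes> x) = J +> \<one>)"
    using x ideal.rcoset_mult_add[OF J] 
    by (auto simp: Units_def FactRing_def A_RCOSETS_def')
  thus ?thesis using rcoset_eq_iff[OF J] x by auto
qed

end

section \<open>Cosets of the image of a subgroup under a homomorphism\<close>

lemma hom_image_coset_eq:
  assumes G: "group G" and S: "subgroup S G" and nu: "\<nu> \<in> hom G H"
    and comm: "\<And>x y. x \<in> carrier G \<Longrightarrow> y \<in> carrier G \<Longrightarrow> \<nu> x \<otimes>\<^bsub>H\<^esub> \<nu> y = \<nu> y \<otimes>\<^bsub>H\<^esub> \<nu> x"
    and u: "u \<in> carrier G" and s: "s \<in> S"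
  shows "\<nu> ` S #>\<^bsub>H\<^esub> \<nu> (u \<otimes>\<^bsub>G\<^esub> s) = \<nu> ` S #>\<^bsub>H\<^esub> \<nu> u"
proof -
  interpret G: group G by fact
  interpret S: subgroup S G by fact
  have sc: "s \<in> carrier G" using s S.subset by auto
  \<comment> \<open>Since values of \<open>\<nu>\<close> commute, \<open>\<nu> s\<close> can be
    moved to the left and absorbed by the image of \<open>S\<close>.\<close>
  have eq: "\<nu> a \<otimes>\<^bsub>H\<^esub> \<nu> (u \<otimes>\<^bsub>G\<^esub> s) = \<nu> (a \<otimes>\<^bsub>G\<^esub> s) \<otimes>\<^bsub>H\<^esub> \<nu> u" if "a \<in> S" for a
  proof -
    have ac: "a \<in> carrier G" using that S.subset by auto
    have "\<nu> a \<otimes>\<^bsub>H\<^esub> \<nu> (u \<otimes>\<^bsub>G\<^esub> s) = \<nu> a \<otimes>\<^bsub>H\<^esub> \<nu> (s \<otimes>\<^bsub>G\<^esub> u)"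
      using comm[OF u sc] hom_mult[OF nu] u sc by simp
    also have "\<dots> = \<nu> (a \<otimes>\<^bsub>G\<^esub> s) \<otimes>\<^bsub>H\<^esub> \<nu> u"
      using ac u sc by (simp add: hom_mult[OF nu, symmetric] G.m_assoc)
    finally show ?thesis .
  qed
  show ?thesis
  proof
    show "\<nu> ` S #>\<^bsub>H\<^esub> \<nu> (u \<otimes>\<^bsub>G\<^esub> s) \<subseteq> \<nu> ` S #>\<^bsub>H\<^esub> \<nu> u"
      using eq S.m_closed[OF _ s] by (auto simp: r_coset_def)
    \<comment> \<open>The inverse of \<open>s\<close> is taken in \<open>G\<close>, since none is
      assumed to exist in \<open>H\<close>.\<close>
    have "\<nu> a \<otimes>\<^bsub>H\<^esub> \<nu> u = \<nu> (a \<otimes>\<^bsub>G\<^esub> inv\<^bsub>G\<^esub> s) \<otimes>\<^bsub>H\<^esub> \<nu> (u \<otimes>\<^bsub>G\<^esub> s)" if "a \<in> S" for a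
      using eq[OF S.m_closed[OF that S.m_inv_closed[OF s]]] sc S.subset that
      by (simp add: G.m_assoc subset_iff)
    thus "\<nu> ` S #>\<^bsub>H\<^esub> \<nu> u \<subseteq> \<nu> ` S #>\<^bsub>H\<^esub> \<nu> (u \<otimes>\<^bsub>G\<^esub> s)"
      using S.m_closed[OF _ S.m_inv_closed[OF s]] by (force simp: r_coset_def)
  qed
qed

text \<open>\<open>\<nu> b\<close> lies in its own coset because \<open>S\<close> contains the
  identity. Equality of the cosets then supplies \<open>s\<close>.\<close>

lemma hom_image_coset_eqD:
  assumes G: "group G" and S: "subgroup S G" and nu: "\<nu> \<in> hom G H"
    and comm: "\<And>x y. x \<in> carrier G \<Longrightarrow> y \<in> carrier G \<Longrightarrow> \<nu> x \<otimes>\<^bsub>H\<^esub> \<nu> y = \<nu> y \<otimes>\<^bsub>H\<^esub> \<nu> x"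
    and u: "u \<in> carrier G" and b: "b \<in> carrier G"
    and eq: "\<nu> ` S #>\<^bsub>H\<^esub> \<nu> b = \<nu> ` S #>\<^bsub>H\<^esub> \<nu> u"
  shows "\<exists>s\<in>S. \<nu> b = \<nu> u \<otimes>\<^bsub>H\<^esub> \<nu> s"
proof -
  interpret G: group G by fact
  interpret S: subgroup S G by fact
  have "\<nu> \<one>\<^bsub>G\<^esub> \<otimes>\<^bsub>H\<^esub> \<nu> b \<in> \<nu> ` S #>\<^bsub>H\<^esub> \<nu> b"
    using S.one_closed unfolding r_coset_def by blast
  hence "\<nu> b \<in> \<nu> ` S #>\<^bsub>H\<^esub> \<nu> b"
    using b by (simp add: hom_mult[OF nu, symmetric])
  hence "\<nu> b \<in> \<nu> ` S #>\<^bsub>H\<^esub> \<nu> u" by (simp only: eq)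
  then obtain s where "s \<in> S" "\<nu> b = \<nu> s \<otimes>\<^bsub>H\<^esub> \<nu> u" unfolding r_coset_def by blast
  thus ?thesis using comm[of s u] u S.subset by auto
qed

text \<open>Only the value \<open>\<nu> b\<close> enters, so \<open>b\<close> may be replaced by
  \<open>u\<close> times \<open>s\<close>, for which the product is the identity.\<close>

lemma hom_quotient_in_kernel:
  assumes G: "group G" and nu: "\<nu> \<in> hom G H" and one: "\<nu> \<one>\<^bsub>G\<^esub> = \<one>\<^bsub>H\<^esub>"
    and b: "b \<in> carrier G" "s \<in> carrier G" "u \<in> carrier G" "\<nu> b = \<nu> u \<otimes>\<^bsub>H\<^esub> \<nu> s"
  shows "b \<otimes>\<^bsub>G\<^esub> inv\<^bsub>G\<^esub> s \<otimes>\<^bsub>G\<^esub> inv\<^bsub>G\<^esub> u \<in> kernel G H \<nu>"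
proof -
  interpret G: group G by fact
  have "\<nu> (b \<otimes>\<^bsub>G\<^esub> inv\<^bsub>G\<^esub> s \<otimes>\<^bsub>G\<^esub> inv\<^bsub>G\<^esub> u) = \<nu> (u \<otimes>\<^bsub>G\<^esub> s \<otimes>\<^bsub>G\<^esub> inv\<^bsub>G\<^esub> s \<otimes>\<^bsub>G\<^esub> inv\<^bsub>G\<^esub> u)"
    using b by (simp add: hom_mult[OF nu])
  also have "u \<otimes>\<^bsub>G\<^esub> s \<otimes>\<^bsub>G\<^esub> inv\<^bsub>G\<^esub> s \<otimes>\<^bsub>G\<^esub> inv\<^bsub>G\<^esub> u = \<one>\<^bsub>G\<^esub>"
    using b by (simp add: G.m_assoc)
  finally show ?thesis using b one by (simp add: kernel_def)
qed

text \<open>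
  No group structure on \<open>H\<close> is assumed: in the application \<open>H\<close> consists of the units modulo \<open>g\<close> of the
  integral closure, which is not shown to be a ring.
\<close>

lemma hom_surj_one:
  assumes "group G" "\<nu> \<in> hom G H" "\<nu> ` carrier G = carrier H" "\<one>\<^bsub>H\<^esub> \<in> carrier H"
    and "\<And>x. x \<in> carrier H \<Longrightarrow> x \<otimes>\<^bsub>H\<^esub> \<one>\<^bsub>H\<^esub> = x"
  shows "\<nu> \<one>\<^bsub>G\<^esub> = \<one>\<^bsub>H\<^esub>"
proof -
  interpret G: group G by fact
  \<comment> \<open>A preimage of the identity takes the place of cancellation in
    \<open>H\<close>.\<close>
  obtain z where z: "z \<in> carrier G" "\<nu> z = \<one>\<^bsub>H\<^esub>" using assms(3,4) by (metis imageE)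
  have "\<nu> \<one>\<^bsub>G\<^esub> = \<nu> \<one>\<^bsub>G\<^esub> \<otimes>\<^bsub>H\<^esub> \<nu> z" 
    using assms(5)[OF hom_in_carrier[OF assms(2) G.one_closed]] z by simp
  also have "\<dots> = \<nu> z" using z(1) by (simp add: hom_mult[OF assms(2), symmetric])
  finally show ?thesis using z by simp
qed

context ring begin

section \<open>Products of cosets\<close>

lemma rcoset_mult_commute:
  assumes "U \<subseteq> centre R" "V \<subseteq> centre R"
  shows "rcoset_mult R J U V = rcoset_mult R J V U"
proof -
  have "x \<otimes> y = y \<otimes> x" if "x \<in> U" "y \<in> V" for x y
    using that assms unfolding centre_def by blast
  hence *: "J +> (x \<otimes> y) = J +> (y \<otimes> x)" if "x \<in> U" "y \<in> V" for x y
    using that by metis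
  have "(\<Union>x\<in>U. \<Union>y\<in>V. J +> (x \<otimes> y)) = (\<Union>x\<in>U. \<Union>y\<in>V. J +> (y \<otimes> x))"
    by (intro SUP_cong refl *)
  thus ?thesis unfolding rcoset_mult_def by (subst (2) SUP_commute)
qed

text \<open>The product of \<open>i \<oplus> x\<close> and \<open>j \<oplus> \<one>\<close> differs
  from \<open>x\<close> by \<open>i \<otimes> j \<oplus> x \<otimes> j \<oplus> i\<close>, which the
  closure conditions place in \<open>J\<close>.\<close>

lemma rcoset_mult_one:
  assumes J: "subgroup J (add_monoid R)" and o: "x \<in> carrier R"
    and cl: "\<And>i j. i \<in> J \<Longrightarrow> j \<in> J \<Longrightarrow> i \<otimes> j \<in> J" "\<And>i. i \<in> J \<Longrightarrow> x \<otimes> i \<in> J"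
  shows "rcoset_mult R J (J +> x) (J +> \<one>) = J +> x"
proof -
  have Jc: "J \<subseteq> carrier R" using subgroup.subset[OF J] by simp
  have Ja: "\<And>i j. i \<in> J \<Longrightarrow> j \<in> J \<Longrightarrow> i \<oplus> j \<in> J" using subgroup.m_closed[OF J] by simp
  have J0: "\<zero> \<in> J" using subgroup.one_closed[OF J] by simp
  have "J +> (a \<otimes> b) = J +> x" if ab: "a \<in> J +> x" "b \<in> J +> \<one>" for a b
  proof -
    obtain i j where ij: "i \<in> J" "j \<in> J" "a = i \<oplus> x" "b = j \<oplus> \<one>" using ab unfolding a_r_coset_def' by auto
    have ijc: "i \<in> carrier R" "j \<in> carrier R" using ij Jc by auto
    have "a \<otimes> b = (i \<otimes> j \<oplus> x \<otimes> j \<oplus> i) \<oplus> x"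
      using ijc o by (simp add: ij l_distr r_distr a_ac)
    moreover have "i \<otimes> j \<oplus> x \<otimes> j \<oplus> i \<in> J" using Ja cl ij by auto
    ultimately have "a \<otimes> b \<in> J +> x" unfolding a_r_coset_def' by blast
    thus ?thesis using a_repr_independence[OF _ o J] by simp
  qed
  moreover have "J +> x \<noteq> {}" "J +> \<one> \<noteq> {}" using J0 unfolding a_r_coset_def' by auto
  ultimately show ?thesis unfolding rcoset_mult_def by auto
qed

lemma rcoset_mult_subring: "rcoset_mult (R\<lparr>carrier := M\<rparr>) J = rcoset_mult R J"
  by (simp add: fun_eq_iff rcoset_mult_def a_r_coset_def')

lemma a_r_coset_subring: "(+>\<^bsub>R\<lparr>carrier := M\<rparr>\<^esub>) = (+>)"
  by (simp add: fun_eq_iff a_r_coset_def')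

section \<open>Cyclic left ideals\<close>

lemma left_ideal_cyclic:
  assumes L: "subring L R" and a: "a \<in> L"
  shows "left_ideal (L #> a) (R\<lparr>carrier := L\<rparr>)"
proof -
  interpret L: ring "R\<lparr>carrier := L\<rparr>" using subring_is_ring[OF L] .
  have Lc: "L \<subseteq> carrier R" using subringE(1)[OF L] .
  have "subgroup (L #>\<^bsub>R\<lparr>carrier := L\<rparr>\<^esub> a) (add_monoid (R\<lparr>carrier := L\<rparr>))"
    using L.subgroup_r_coset[OF subring.axioms(1)[OF L.carrier_is_subring]] a by simp
  moreover have "L #>\<^bsub>R\<lparr>carrier := L\<rparr>\<^esub> a = L #> a" by (simp add: r_coset_def)
  moreover have "r \<otimes> x \<in> L #> a" if r: "r \<in> L" and x: "x \<in> L #> a" for r x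
  proof -
    obtain l where l: "l \<in> L" "x = l \<otimes> a" using x unfolding r_coset_def by auto
    have "r \<otimes> x = (r \<otimes> l) \<otimes> a" using l r a Lc by (simp add: m_assoc subset_iff)
    thus ?thesis using subringE(6)[OF L r l(1)] unfolding r_coset_def by blast
  qed
  ultimately show ?thesis unfolding left_ideal_def additive_subgroup_def by simp
qed

lemma ideal_prod_cyclic:
  assumes M: "subring M R" and L: "subring L R" "L \<subseteq> M" and a: "a \<in> M"
  shows "M \<cdot> (L #> a) = M #> a"
proof
  have Mc: "M \<subseteq> carrier R" using subringE(1)[OF M] .
  show "M \<cdot> (L #> a) \<subseteq> M #> a"
  proof
    fix z assume "z \<in> M \<cdot> (L #> a)"
    thus "z \<in> M #> a"
    proof (induction z rule: ideal_prod.induct)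
      case (prod i j)
      then obtain l where l: "l \<in> L" "j = l \<otimes> a" unfolding r_coset_def by auto
      have lM: "l \<in> M" using l L by auto
      have "i \<otimes> j = (i \<otimes> l) \<otimes> a" using l lM prod(1) a Mc by (simp add: m_assoc subset_iff)
      thus ?case using subringE(6)[OF M prod(1) lM] unfolding r_coset_def by blast
    next
      case (sum s t)
      then obtain m n where m: "m \<in> M" "n \<in> M" "s = m \<otimes> a" "t = n \<otimes> a" unfolding r_coset_def by auto
      have "s \<oplus> t = (m \<oplus> n) \<otimes> a" using m a Mc by (simp add: l_distr subset_iff)
      thus ?case using subringE(7)[OF M m(1,2)] unfolding r_coset_def by blast
    qed
  qed
  show "M #> a \<subseteq> M \<cdot> (L #> a)"
  proof
    fix z assume "z \<in> M #> a"
    then obtain m where m: "m \<in> M" "z = m \<otimes> a" unfolding r_coset_def by auto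
    have "\<one> \<otimes> a \<in> L #> a" using subringE(3)[OF L(1)] unfolding r_coset_def by blast
    moreover have "\<one> \<otimes> a = a" using a Mc by auto
    ultimately show "z \<in> M \<cdot> (L #> a)" using m ideal_prod.prod[of m M a] by simp
  qed
qed

text \<open>Modulo \<open>f\<close> the element \<open>y\<close> is a left inverse of
  \<open>a\<close>, so each \<open>l\<close> in \<open>L\<close> is congruent to
  \<open>(l \<otimes> y) \<otimes> a\<close>.\<close>

lemma cyclic_add_ideal:
  assumes L: "subring L R" and f: "ideal f (R\<lparr>carrier := L\<rparr>)" and a: "a \<in> L" and y: "y \<in> L" "y \<otimes> a \<in> f +> \<one>"
  shows "(L #> a) <+>\<^bsub>R\<^esub> f = L"
proof
  have Lc: "L \<subseteq> carrier R" using subringE(1)[OF L] .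
  have fL: "f \<subseteq> L" using ideal.Icarr[OF f] by auto
  have f': "subgroup f (add_monoid R)" using additive_subgroup_of_subring[OF L ideal.axioms(1)[OF f]] .
  show "(L #> a) <+>\<^bsub>R\<^esub> f \<subseteq> L"
    using fL subringE(6)[OF L _ a] subringE(7)[OF L] unfolding set_add_def' r_coset_def by auto
  show "L \<subseteq> (L #> a) <+>\<^bsub>R\<^esub> f"
  proof
    fix l assume l: "l \<in> L"
    obtain j where j: "j \<in> f" "y \<otimes> a = j \<oplus> \<one>" using y(2) unfolding a_r_coset_def' by auto
    have carr: "l \<in> carrier R" "j \<in> carrier R" "y \<in> carrier R" "a \<in> carrier R" using l j y a fL Lc by auto
    have "(l \<otimes> y) \<otimes> a = l \<otimes> j \<oplus> l" using carr by (simp add: m_assoc j(2) r_distr)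
    hence "l = (l \<otimes> y) \<otimes> a \<oplus> \<ominus> (l \<otimes> j)" using carr by (simp add: a_ac r_neg)
    moreover have "l \<otimes> j \<in> f" using ideal.I_l_closed[OF f j(1)] l by simp
    hence "\<ominus> (l \<otimes> j) \<in> f" using subgroup.m_inv_closed[OF f'] by (simp add: a_inv_def)
    moreover have "l \<otimes> y \<in> L" using subringE(6)[OF L l y(1)] .
    ultimately show "l \<in> (L #> a) <+>\<^bsub>R\<^esub> f" unfolding set_add_def' r_coset_def by blast
  qed
qed

section \<open>Ideals, units and inverses in subrings\<close>

lemma ideal_subring_restrict:
  assumes M: "subring M R" and L: "subring L R" "L \<subseteq> M" and f: "ideal f (R\<lparr>carrier := M\<rparr>)" "f \<subseteq> L"
  shows "ideal f (R\<lparr>carrier := L\<rparr>)"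
proof (rule idealI)
  show "ring (R\<lparr>carrier := L\<rparr>)" using subring_is_ring[OF L(1)] .
  interpret L: ring "R\<lparr>carrier := L\<rparr>" by fact
  have f': "subgroup f (add_monoid R)" using additive_subgroup_of_subring[OF M ideal.axioms(1)[OF f(1)]] .
  have "subgroup f ((add_monoid R)\<lparr>carrier := L\<rparr>)"
    using add.subgroup_incl[OF f' subring.axioms(1)[OF L(1)] f(2)] .
  thus "subgroup f (add_monoid (R\<lparr>carrier := L\<rparr>))" by simp
qed (use ideal.I_l_closed[OF f(1)] ideal.I_r_closed[OF f(1)] L(2) in auto)

text \<open>Both quotients consist of cosets of \<open>f\<close> formed in the ambient ring and
  multiply them alike, so an inverse in the smaller quotient is one in the larger.\<close>

lemma Units_subring_Quot_subgroup:
  assumes M: "subring M R" and L: "subring L R" "L \<subseteq> M"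
    and f: "ideal f (R\<lparr>carrier := M\<rparr>)" "f \<subseteq> L"
  shows "subgroup (Units (R\<lparr>carrier := L\<rparr> Quot f)) (units_of (R\<lparr>carrier := M\<rparr> Quot f))"
proof -
  let ?Q = "R\<lparr>carrier := M\<rparr> Quot f" and ?P = "R\<lparr>carrier := L\<rparr> Quot f"
  have fL: "ideal f (R\<lparr>carrier := L\<rparr>)" using ideal_subring_restrict[OF M L f] .
  interpret Q: ring ?Q using ideal.quotient_is_ring[OF f(1)] .
  interpret P: ring ?P using ideal.quotient_is_ring[OF fL] .
  have ops: "Group.monoid.mult ?P = Group.monoid.mult ?Q" "Group.monoid.one ?P = Group.monoid.one ?Q"
    by (simp_all add: FactRing_def rcoset_mult_subring a_r_coset_subring)
  have "carrier ?P \<subseteq> carrier ?Q"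
    using L(2) by (auto simp: FactRing_def A_RCOSETS_def' a_r_coset_subring)
  hence "Units ?P \<subseteq> Units ?Q" unfolding Units_def ops by blast
  moreover have "(units_of ?Q)\<lparr>carrier := Units ?P\<rparr> = units_of ?P"
    by (simp add: units_of_def ops)
  ultimately show ?thesis
    using group.group_incl_imp_subgroup[OF Q.units_group, of "Units ?P"] P.units_group
    by (simp add: units_of_carrier)
qed

lemma left_inverse_mod_ideal_of_subring:
  assumes M: "subring M R" and Z: "Z \<subseteq> M" "Z \<subseteq> centre R" and Us: "set Us \<subseteq> M" "Span Z Us = M"
    and J: "ideal J (R\<lparr>carrier := M\<rparr>)" and bc: "b \<in> M" "c \<in> M" "c \<otimes> b \<in> J +> \<one>"
  shows "b \<otimes> c \<in> J +> \<one>"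
proof -
  interpret M: ring "R\<lparr>carrier := M\<rparr>" using subring_is_ring[OF M] .
  have "Z \<subseteq> centre (R\<lparr>carrier := M\<rparr>)" using Z subringE(1)[OF M] by (auto simp: centre_def)
  thus ?thesis
    using M.left_inverse_mod_ideal_imp_right_inverse[of Z Us J b c] Us J bc
    by (simp add: Span_consistent[OF M] a_r_coset_subring del: Span.simps)
qed

text \<open>The left ideal generated by \<open>a\<close> contains a spanning set, hence
  \<open>\<one>\<close>, so \<open>a\<close> has a left inverse. Modulo the zero ideal the result on
  one-sided inverses makes it a right inverse, by which \<open>a\<close> can be cancelled.\<close>

lemma full_subset_principal_imp_injective:
  assumes K: "K \<subseteq> centre R" and I: "full R K I" "I \<subseteq> carrier R"
    and a: "a \<in> carrier R" "I \<subseteq> carrier R #> a" and l: "l \<in> carrier R" "l \<otimes> a = \<zero>"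
  shows "l = \<zero>"
proof -
  obtain Us where Us: "set Us \<subseteq> I" "Span K Us = carrier R" using I(1) unfolding full_def by blast
  have Kc: "K \<subseteq> carrier R" using K unfolding centre_def by blast
  have "Span K Vs \<subseteq> carrier R #> a" if "set Vs \<subseteq> carrier R #> a" for Vs
    using that
  proof (induction Vs)
    case Nil
    have "\<zero> = \<zero> \<otimes> a" using a by simp
    thus ?case unfolding r_coset_def by auto
  next
    case (Cons u Us)
    show ?case
    proof
      fix x assume "x \<in> Span K (u # Us)"
      then obtain k v where k: "k \<in> K" "v \<in> Span K Us" "x = k \<otimes> u \<oplus> v"
        by (auto simp: line_extension_def set_add_def' r_coset_def)
      moreover obtain s t where st: "s \<in> carrier R" "u = s \<otimes> a" "t \<in> carrier R" "v = t \<otimes> a"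
        using Cons k(2) unfolding r_coset_def by force
      moreover have "k \<in> carrier R" using k Kc by auto
      ultimately have "x = (k \<otimes> s \<oplus> t) \<otimes> a" "k \<otimes> s \<oplus> t \<in> carrier R"
        using a by (auto simp: l_distr m_assoc)
      thus "x \<in> carrier R #> a" unfolding r_coset_def by blast
    qed
  qed
  hence "\<one> \<in> carrier R #> a" using Us a(2) by blast
  then obtain c where c: "c \<in> carrier R" "c \<otimes> a = \<one>" unfolding r_coset_def by auto
  have "a \<otimes> c \<in> {\<zero>} +> \<one>"
  proof (rule left_inverse_mod_ideal_imp_right_inverse[OF K Us(2) _ zeroideal a(1) c(1)])
    show "set Us \<subseteq> carrier R" using Us(1) I(2) by blast
    show "c \<otimes> a \<in> {\<zero>} +> \<one>" unfolding c(2) a_r_coset_def' by simp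
  qed
  hence ac: "a \<otimes> c = \<one>" by (auto simp: a_r_coset_def')
  have "l = l \<otimes> (a \<otimes> c)" using ac l(1) by simp
  also have "\<dots> = \<zero>" using a(1) c(1) l by (simp add: m_assoc[symmetric])
  finally show ?thesis .
qed

lemma centre_m_closed:
  assumes "x \<in> centre R" "y \<in> centre R"
  shows "x \<otimes> y \<in> centre R"
proof -
  have c: "x \<in> carrier R" "y \<in> carrier R" using assms unfolding centre_def by auto
  have "x \<otimes> y \<otimes> z = z \<otimes> (x \<otimes> y)" if z: "z \<in> carrier R" for z
  proof -
    have "x \<otimes> y \<otimes> z = x \<otimes> (z \<otimes> y)" using assms(2) c z unfolding centre_def by (simp add: m_assoc)
    also have "\<dots> = (x \<otimes> z) \<otimes> y" using c z by (simp add: m_assoc)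
    also have "x \<otimes> z = z \<otimes> x" using assms(1) z unfolding centre_def by simp
    finally show ?thesis using c z by (simp add: m_assoc)
  qed
  thus ?thesis using c unfolding centre_def by simp
qed

section \<open>Unity in the integral closure\<close>

lemma one_in_integral_closure:
  assumes "\<one> \<in> S" "\<ominus> \<one> \<in> S" "\<one> \<in> T"
  shows "\<one> \<in> integral_closure R S T"
proof -
  have "eval [\<one>, \<ominus> \<one>] \<one> = \<zero>" by (simp add: r_neg)
  thus ?thesis using assms unfolding integral_closure_def by (intro CollectI conjI exI[of _ "[\<one>, \<ominus> \<one>]"]) auto
qed

text \<open>The equation is X + 1 = 0. The ring of integers has to contain
  \<open>\<ominus> \<one>\<close> because X - 1, the polynomial used for \<open>\<one>\<close>, has
  it as a coefficient.\<close>

lemma minus_one_in_integral_closure: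
  assumes "\<one> \<in> S" "\<ominus> \<one> \<in> T"
  shows "\<ominus> \<one> \<in> integral_closure R S T"
proof -
  have "eval [\<one>, \<one>] (\<ominus> \<one>) = \<zero>" by (simp add: l_neg)
  thus ?thesis using assms unfolding integral_closure_def by (intro CollectI conjI exI[of _ "[\<one>, \<one>]"]) auto
qed

lemma one_in_ring_of_integers:
  assumes "subfield K R"
  shows "\<one> \<in> ring_of_integers R K" "\<ominus> \<one> \<in> ring_of_integers R K"
proof -
  have 1: "\<one> \<in> range (\<lambda>n::int. add_pow R n \<one>)"
    using add.int_pow_1[of \<one>] unfolding add_pow_def by (metis one_closed add.int_pow_1 rangeI)
  have 2: "\<ominus> \<one> \<in> range (\<lambda>n::int. add_pow R n \<one>)"
  proof
    show "\<ominus> \<one> = add_pow R (- 1 :: int) \<one>"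
      using add.int_pow_neg[of \<one> 1] add.int_pow_1[of \<one>] unfolding add_pow_def by (simp add: a_inv_def)
  qed simp
  note K = subringE(3,5)[OF subfieldE(1)[OF assms]]
  show "\<one> \<in> ring_of_integers R K" "\<ominus> \<one> \<in> ring_of_integers R K"
    unfolding ring_of_integers_def
    using 1 2 K by (auto intro: one_in_integral_closure minus_one_in_integral_closure)
qed

end

theorem theorem4p5:
  fixes A :: "('a, 'b) ring_scheme"
    and K \<O> C O\<^sub>C \<Lambda> M f g I :: "'a set"
    and \<nu> f\<^sub>2 \<pi>\<^sub>2 f\<^sub>1 and \<beta> :: 'a
  assumes A: "ring A" "semisimple_ring A"
    and K: "subfield K A" "K \<subseteq> centre A" "number_field (A\<lparr>carrier := K\<rparr>)"
    and fin_dim: "ring.finite_dimension A K (carrier A)"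
    and \<O>: "\<O> = ring_of_integers A K"
    and C: "C = centre A"
    and O\<^sub>C: "O\<^sub>C = integral_closure A \<O> C"
    and \<Lambda>: "is_order A K \<Lambda>"
    and M: "is_maximal_order A K M" "\<Lambda> \<subseteq> M"
    and f: "ideal f (A\<lparr>carrier := M\<rparr>)" "f \<noteq> M" "full A K f" "f \<subseteq> \<Lambda>"
    and g: "g = f \<inter> C"
    and \<nu>: "is_reduced_norm_mod A M f O\<^sub>C g \<nu>"
    and f\<^sub>1: "f\<^sub>1 = (\<lambda>v. f +>\<^bsub>A\<^esub> v)"
    and f\<^sub>2: "f\<^sub>2 = (\<lambda>c. g +>\<^bsub>A\<^esub> c)"
    and \<pi>\<^sub>2: "\<pi>\<^sub>2 = (\<lambda>y. \<nu> ` Units (A\<lparr>carrier := \<Lambda>\<rparr> Quot f) #>\<^bsub>units_of (A\<lparr>carrier := O\<^sub>C\<rparr> Quot g)\<^esub> y)"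
    and I: "left_ideal I (A\<lparr>carrier := \<Lambda>\<rparr>)" "I <+>\<^bsub>A\<^esub> f = \<Lambda>"
    and \<beta>: "\<beta> \<in> M" "M \<cdot>\<^bsub>A\<^esub> I = M #>\<^bsub>A\<^esub> \<beta>"
  shows "(f +>\<^bsub>A\<^esub> \<beta> \<in> Units (A\<lparr>carrier := M\<rparr> Quot f)) \<and>
    (free_left_module A \<Lambda> I \<longrightarrow>
      \<pi>\<^sub>2 (\<nu> (f +>\<^bsub>A\<^esub> \<beta>)) \<in> (\<pi>\<^sub>2 \<circ> f\<^sub>2) ` (reduced_norm A ` Units (A\<lparr>carrier := M\<rparr>))) \<and>
    (f\<^sub>1 ` SL A M O\<^sub>C = SL_mod A M f O\<^sub>C g \<nu> \<longrightarrow>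
      (\<pi>\<^sub>2 (\<nu> (f +>\<^bsub>A\<^esub> \<beta>)) \<in> (\<pi>\<^sub>2 \<circ> f\<^sub>2) ` (reduced_norm A ` Units (A\<lparr>carrier := M\<rparr>)) \<longrightarrow>
         (\<exists>\<alpha>\<in>\<Lambda>. I = \<Lambda> #>\<^bsub>A\<^esub> \<alpha>) \<and> (full A K I \<longrightarrow> free_left_module A \<Lambda> I)) \<and>
      (\<forall>u\<in>Units (A\<lparr>carrier := M\<rparr>). \<forall>a\<in>Units (A\<lparr>carrier := \<Lambda>\<rparr> Quot f).
         \<nu> (f +>\<^bsub>A\<^esub> \<beta>) =
           \<nu> (f +>\<^bsub>A\<^esub> u) \<otimes>\<^bsub>A\<lparr>carrier := O\<^sub>C\<rparr> Quot g\<^esub> \<nu> a \<longrightarrow>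
         (\<forall>v\<in>SL A M O\<^sub>C.
            f\<^sub>1 v = (f +>\<^bsub>A\<^esub> \<beta>) \<otimes>\<^bsub>A\<lparr>carrier := M\<rparr> Quot f\<^esub> inv\<^bsub>A\<lparr>carrier := M\<rparr> Quot f\<^esub> a
                     \<otimes>\<^bsub>A\<lparr>carrier := M\<rparr> Quot f\<^esub> inv\<^bsub>A\<lparr>carrier := M\<rparr> Quot f\<^esub> (f +>\<^bsub>A\<^esub> u) \<longrightarrow>
            I = \<Lambda> #>\<^bsub>A\<^esub> (inv\<^bsub>A\<lparr>carrier := M\<rparr>\<^esub> (v \<otimes>\<^bsub>A\<^esub> u) \<otimes>\<^bsub>A\<^esub> \<beta>))))"
proof -

  \<comment> \<open>The quotient rings and their units\<close>
  interpret A: ring A by fact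
  let ?M = "A\<lparr>carrier := M\<rparr>" and ?L = "A\<lparr>carrier := \<Lambda>\<rparr>"
  let ?Q = "?M Quot f" and ?P = "?L Quot f" and ?T = "A\<lparr>carrier := O\<^sub>C\<rparr> Quot g"
  have Mr: "subring M A" and Lr: "subring \<Lambda> A"
    using M \<Lambda> unfolding is_maximal_order_def is_order_def by auto
  have Mc: "M \<subseteq> carrier A" and Lc: "\<Lambda> \<subseteq> carrier A" using subringE(1) Mr Lr by auto
  have fL: "ideal f ?L" using A.ideal_subring_restrict[OF Mr Lr M(2) f(1,4)] .
  have fc: "f \<subseteq> carrier A" using f(4) Lc by auto
  interpret M: ring ?M using A.subring_is_ring[OF Mr] .
  interpret L: ring ?L using A.subring_is_ring[OF Lr] .
  interpret Q: ring ?Q using ideal.quotient_is_ring[OF f(1)] .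
  interpret P: ring ?P using ideal.quotient_is_ring[OF fL] .
  interpret GQ: group "units_of ?Q" using Q.units_group .
  have cosM: "(+>\<^bsub>?M\<^esub>) = (+>\<^bsub>A\<^esub>)" and cosL: "(+>\<^bsub>?L\<^esub>) = (+>\<^bsub>A\<^esub>)"
    using A.a_r_coset_subring by auto
  have QM: "f +>\<^bsub>A\<^esub> x \<in> Units ?Q \<longleftrightarrow>
      (\<exists>y\<in>M. x \<otimes>\<^bsub>A\<^esub> y \<in> f +>\<^bsub>A\<^esub> \<one>\<^bsub>A\<^esub> \<and> y \<otimes>\<^bsub>A\<^esub> x \<in> f +>\<^bsub>A\<^esub> \<one>\<^bsub>A\<^esub>)" if "x \<in> M" for x
    using M.Units_Quot_iff[OF f(1), of x] that by (simp add: cosM)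
  have QL: "f +>\<^bsub>A\<^esub> x \<in> Units ?P \<longleftrightarrow>
      (\<exists>y\<in>\<Lambda>. x \<otimes>\<^bsub>A\<^esub> y \<in> f +>\<^bsub>A\<^esub> \<one>\<^bsub>A\<^esub> \<and> y \<otimes>\<^bsub>A\<^esub> x \<in> f +>\<^bsub>A\<^esub> \<one>\<^bsub>A\<^esub>)" if "x \<in> \<Lambda>" for x
    using L.Units_Quot_iff[OF fL, of x] that by (simp add: cosL)
  have Qmult: "(f +>\<^bsub>A\<^esub> x) \<otimes>\<^bsub>?Q\<^esub> (f +>\<^bsub>A\<^esub> y) = f +>\<^bsub>A\<^esub> (x \<otimes>\<^bsub>A\<^esub> y)" if "x \<in> M" "y \<in> M" for x y
    using ideal.rcoset_mult_add[OF f(1), of x y] that by (simp add: FactRing_def cosM)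
  have S: "subgroup (Units ?P) (units_of ?Q)"
    using A.Units_subring_Quot_subgroup[OF Mr Lr M(2) f(1,4)] .
  have SQ: "Units ?P \<subseteq> Units ?Q" using subgroup.subset[OF S] by (simp add: units_of_carrier)

  \<comment> \<open>Generators of \<open>M\<close> and integral elements\<close>
  obtain Us where Us: "set Us \<subseteq> M" "A.Span \<O> Us = M"
    using M(1) unfolding is_maximal_order_def is_order_def \<O> by blast
  have OM: "\<O> \<subseteq> M" using A.ring_of_integers_subset_maximal_order[OF M(1) K(1,2)] \<O> by simp
  have OK: "\<O> \<subseteq> K" unfolding \<O> ring_of_integers_def integral_closure_def by blast
  have OCM: "O\<^sub>C \<subseteq> M"
    using A.integral_closure_subset_maximal_order[OF M(1) K(1,2)] O\<^sub>C C \<O> by simp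
  \<comment> \<open>One-sided inverses are two-sided both modulo \<open>f\<close> and, with the zero
    ideal as \<open>J\<close>, in \<open>M\<close> itself.\<close>
  have ded: "b \<otimes>\<^bsub>A\<^esub> c \<in> J +>\<^bsub>A\<^esub> \<one>\<^bsub>A\<^esub>"
    if "ideal J ?M" "b \<in> M" "c \<in> M" "c \<otimes>\<^bsub>A\<^esub> b \<in> J +>\<^bsub>A\<^esub> \<one>\<^bsub>A\<^esub>" for J b c
    using A.left_inverse_mod_ideal_of_subring[OF Mr OM _ Us that] OK K(2) by blast

  \<comment> \<open>Elements of \<open>I\<close> and \<open>f\<close>\<close>
  have I': "I \<subseteq> \<Lambda>" "\<And>l x. l \<in> \<Lambda> \<Longrightarrow> x \<in> I \<Longrightarrow> l \<otimes>\<^bsub>A\<^esub> x \<in> I" "subgroup I (add_monoid A)"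
    using I(1) additive_subgroup.a_subset[of I ?L] A.additive_subgroup_of_subring[OF Lr]
    unfolding left_ideal_def by auto
  have f': "subgroup f (add_monoid A)"
    using A.additive_subgroup_of_subring[OF Mr ideal.axioms(1)[OF f(1)]] .
  have f1: "\<one>\<^bsub>A\<^esub> \<notin> f" using ideal.one_imp_carrier[OF f(1)] f(2) by auto
  have IMI: "x \<in> M #>\<^bsub>A\<^esub> \<beta>" if "x \<in> I" for x
  proof -
    have "\<one>\<^bsub>A\<^esub> \<otimes>\<^bsub>A\<^esub> x \<in> M \<cdot>\<^bsub>A\<^esub> I" using subringE(3)[OF Mr] that by (rule ideal_prod.prod)
    moreover have "x \<in> carrier A" using that I'(1) Lc by auto
    ultimately show ?thesis using \<beta>(2) by simp
  qed
  have \<beta>c: "\<beta> \<in> carrier A" using \<beta> Mc by auto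
  have \<beta>M: "\<beta> \<in> M #>\<^bsub>A\<^esub> \<beta>"
  proof -
    have "\<one>\<^bsub>A\<^esub> \<otimes>\<^bsub>A\<^esub> \<beta> \<in> M #>\<^bsub>A\<^esub> \<beta>" using subringE(3)[OF Mr] unfolding r_coset_def by blast
    thus ?thesis using \<beta>c by simp
  qed

  \<comment> \<open>Invertibility modulo \<open>f\<close>\<close>
  obtain \<gamma> where \<gamma>: "\<gamma> \<in> M" "\<gamma> \<otimes>\<^bsub>A\<^esub> \<beta> \<in> f +>\<^bsub>A\<^esub> \<one>\<^bsub>A\<^esub>"
  proof -
    \<comment> \<open>In a decomposition of \<open>\<one>\<close> along \<open>I\<close> and
      \<open>f\<close>, the part in \<open>I\<close> is a left multiple of \<open>\<beta>\<close>;
      the multiplier serves as \<open>\<gamma>\<close>.\<close>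
    have "\<one>\<^bsub>A\<^esub> \<in> I <+>\<^bsub>A\<^esub> f" using I(2) subringE(3)[OF Lr] by simp
    then obtain x p where x: "x \<in> I" "p \<in> f" "\<one>\<^bsub>A\<^esub> = x \<oplus>\<^bsub>A\<^esub> p" unfolding set_add_def' by auto
    obtain m where m: "m \<in> M" "x = m \<otimes>\<^bsub>A\<^esub> \<beta>" using IMI[OF x(1)] unfolding r_coset_def by auto
    have carr: "x \<in> carrier A" "p \<in> carrier A" using x I'(1) Lc fc by auto
    have "x = \<ominus>\<^bsub>A\<^esub> p \<oplus>\<^bsub>A\<^esub> (x \<oplus>\<^bsub>A\<^esub> p)" using carr by (simp add: A.a_comm[of x p] A.r_neg1)
    moreover have "\<ominus>\<^bsub>A\<^esub> p \<in> f" using subgroup.m_inv_closed[OF f' x(2)] by (simp add: a_inv_def)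
    ultimately have "x \<in> f +>\<^bsub>A\<^esub> \<one>\<^bsub>A\<^esub>" unfolding a_r_coset_def' x(3) by blast
    thus ?thesis using that m by blast
  qed
  have \<beta>\<gamma>: "\<beta> \<otimes>\<^bsub>A\<^esub> \<gamma> \<in> f +>\<^bsub>A\<^esub> \<one>\<^bsub>A\<^esub>" using ded[OF f(1) \<beta>(1) \<gamma>] .
  have U\<beta>: "f +>\<^bsub>A\<^esub> \<beta> \<in> Units ?Q"
    unfolding QM[OF \<beta>(1)] using \<beta>\<gamma> \<gamma> by blast
  have UM: "f +>\<^bsub>A\<^esub> u \<in> Units ?Q" if u: "u \<in> Units ?M" for u
  proof -
    obtain w where w: "u \<in> M" "w \<in> M" "u \<otimes>\<^bsub>A\<^esub> w = \<one>\<^bsub>A\<^esub>" "w \<otimes>\<^bsub>A\<^esub> u = \<one>\<^bsub>A\<^esub>"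
      using u unfolding Units_def by auto
    have "\<one>\<^bsub>A\<^esub> = \<zero>\<^bsub>A\<^esub> \<oplus>\<^bsub>A\<^esub> \<one>\<^bsub>A\<^esub>" by simp
    moreover have "\<zero>\<^bsub>A\<^esub> \<in> f" using subgroup.one_closed[OF f'] by simp
    ultimately have "\<one>\<^bsub>A\<^esub> \<in> f +>\<^bsub>A\<^esub> \<one>\<^bsub>A\<^esub>" unfolding a_r_coset_def' by blast
    thus ?thesis unfolding QM[OF w(1)] using w by (intro bexI[of _ w]) simp_all
  qed

  \<comment> \<open>The homomorphism \<open>\<nu>\<close> and commutativity of its values\<close>
  have \<nu>hom: "\<nu> \<in> hom (units_of ?Q) (units_of ?T)" and \<nu>img: "\<nu> ` Units ?Q = Units ?T"
    and \<nu>nr: "\<And>x. x \<in> M \<Longrightarrow> f +>\<^bsub>A\<^esub> x \<in> Units ?Q \<Longrightarrow> \<nu> (f +>\<^bsub>A\<^esub> x) = g +>\<^bsub>A\<^esub> reduced_norm A x"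
    using \<nu> unfolding is_reduced_norm_mod_def by auto
  have Tmult: "Group.monoid.mult (units_of ?T) = rcoset_mult A g"
    and Tone: "Group.monoid.one (units_of ?T) = g +>\<^bsub>A\<^esub> \<one>\<^bsub>A\<^esub>"
    by (simp_all add: units_of_def FactRing_def A.rcoset_mult_subring A.a_r_coset_subring)
  have Tc: "\<exists>x\<in>O\<^sub>C. y = g +>\<^bsub>A\<^esub> x" if "y \<in> Units ?T" for y
    using that by (auto simp: Units_def FactRing_def A_RCOSETS_def' A.a_r_coset_subring)
  have Ccl: "x \<oplus>\<^bsub>A\<^esub> y \<in> C" if "x \<in> C" "y \<in> C" for x y
    using that unfolding C centre_def by (auto simp: A.l_distr A.r_distr)
  \<comment> \<open>Commutativity of the target is obtained from representatives: as
    \<open>g\<close> and the integral closure lie in the centre, so does every element of these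
    cosets.\<close>
  have Tcen: "y \<subseteq> centre A" if y: "y \<in> Units ?T" for y
  proof -
    obtain x where x: "x \<in> O\<^sub>C" "y = g +>\<^bsub>A\<^esub> x" using Tc[OF y] by blast
    have "x \<in> C" using x unfolding O\<^sub>C integral_closure_def by blast
    thus ?thesis using Ccl x unfolding g C by (auto simp: a_r_coset_def')
  qed
  have \<nu>U: "\<nu> x \<in> Units ?T" if "x \<in> carrier (units_of ?Q)" for x
    using \<nu>img that by (auto simp: units_of_carrier)
  have \<nu>comm: "\<nu> x \<otimes>\<^bsub>units_of ?T\<^esub> \<nu> y = \<nu> y \<otimes>\<^bsub>units_of ?T\<^esub> \<nu> x"
    if "x \<in> carrier (units_of ?Q)" "y \<in> carrier (units_of ?Q)" for x y
    unfolding Tmult using A.rcoset_mult_commute[OF Tcen[OF \<nu>U[OF that(1)]] Tcen[OF \<nu>U[OF that(2)]]] .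

  \<comment> \<open>The necessary condition for freeness\<close>
  have free_imp: "\<pi>\<^sub>2 (\<nu> (f +>\<^bsub>A\<^esub> \<beta>)) \<in> (\<pi>\<^sub>2 \<circ> f\<^sub>2) ` (reduced_norm A ` Units ?M)"
    if free: "free_left_module A \<Lambda> I"
  proof -
    have I0: "\<zero>\<^bsub>A\<^esub> \<in> I" using subgroup.one_closed[OF I'(3)] by simp
    have "I \<noteq> {\<zero>\<^bsub>A\<^esub>}"
    proof
      assume "I = {\<zero>\<^bsub>A\<^esub>}"
      hence "\<one>\<^bsub>A\<^esub> \<in> {\<zero>\<^bsub>A\<^esub>} <+>\<^bsub>A\<^esub> f" using I(2) subringE(3)[OF Lr] by simp
      then obtain p where "p \<in> f" "\<one>\<^bsub>A\<^esub> = \<zero>\<^bsub>A\<^esub> \<oplus>\<^bsub>A\<^esub> p" unfolding set_add_def' by auto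
      thus False using f1 fc by auto
    qed
    moreover have "False" if "b \<in> I" "b' \<in> I"
      "\<And>x y. x \<in> \<Lambda> \<Longrightarrow> y \<in> \<Lambda> \<Longrightarrow> x \<otimes>\<^bsub>A\<^esub> b \<oplus>\<^bsub>A\<^esub> y \<otimes>\<^bsub>A\<^esub> b' = \<zero>\<^bsub>A\<^esub> \<Longrightarrow> x = \<zero>\<^bsub>A\<^esub> \<and> y = \<zero>\<^bsub>A\<^esub>" for b b'
      using A.no_independent_pair[OF K(1) Mr Us(1) OK OM Us(2) Lr M(2) f(1,3,4) _ _ that(3)] that(1,2) I'(1)
      by blast
    ultimately obtain a where a: "a \<in> I" "I = \<Lambda> #>\<^bsub>A\<^esub> a"
      and inj: "\<And>l. l \<in> \<Lambda> \<Longrightarrow> l \<otimes>\<^bsub>A\<^esub> a = \<zero>\<^bsub>A\<^esub> \<Longrightarrow> l = \<zero>\<^bsub>A\<^esub>"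
      using A.free_left_module_imp_cyclic[OF free Lr _ _ _ I'(2)] I'(1) Lc I0 by blast
    have aL: "a \<in> \<Lambda>" and aM: "a \<in> M" and ac: "a \<in> carrier A" using a(1) I'(1) M(2) Lc by auto
    \<comment> \<open>Multiplication by \<open>f\<close> brings \<open>m\<close> into
      \<open>\<Lambda>\<close>, where \<open>inj\<close> applies; fullness of \<open>f\<close> then
      gives \<open>m\<close> zero.\<close>
    have injM: "m = \<zero>\<^bsub>A\<^esub>" if m: "m \<in> M" "m \<otimes>\<^bsub>A\<^esub> a = \<zero>\<^bsub>A\<^esub>" for m
    proof (rule A.full_left_annihilator[OF _ f(3) fc])
      fix p assume p: "p \<in> f"
      have "(p \<otimes>\<^bsub>A\<^esub> m) \<otimes>\<^bsub>A\<^esub> a = p \<otimes>\<^bsub>A\<^esub> (m \<otimes>\<^bsub>A\<^esub> a)" using p fc m(1) Mc ac by (intro A.m_assoc) auto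
      also have "\<dots> = \<zero>\<^bsub>A\<^esub>" using m(2) p fc by auto
      finally show "p \<otimes>\<^bsub>A\<^esub> m = \<zero>\<^bsub>A\<^esub>"
        using inj ideal.I_r_closed[OF f(1) p, of m] m(1) f(4) by auto
    qed (use m(1) Mc K(2) in \<open>auto simp: centre_def\<close>)
    have "M #>\<^bsub>A\<^esub> \<beta> = M #>\<^bsub>A\<^esub> a" using A.ideal_prod_cyclic[OF Mr Lr M(2) aM] \<beta>(2) a(2) by simp
    hence "\<beta> \<in> M #>\<^bsub>A\<^esub> a" using \<beta>M by blast
    \<comment> \<open>\<open>a\<close> and \<open>\<beta>\<close> generate the same left ideal of
      \<open>M\<close>, so each is a multiple of the other. Cancelling \<open>a\<close> shows that
      the multipliers are inverse on one side, and \<open>ded\<close> with the zero ideal gives the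
      other.\<close>
    then obtain u where u: "u \<in> M" "\<beta> = u \<otimes>\<^bsub>A\<^esub> a" unfolding r_coset_def by blast
    obtain w where w: "w \<in> M" "a = w \<otimes>\<^bsub>A\<^esub> \<beta>" using IMI[OF a(1)] unfolding r_coset_def by blast
    have uc: "u \<in> carrier A" and wc: "w \<in> carrier A" using u w Mc by auto
    have wu: "w \<otimes>\<^bsub>A\<^esub> u = \<one>\<^bsub>A\<^esub>"
    proof -
      have "(w \<otimes>\<^bsub>A\<^esub> u) \<otimes>\<^bsub>A\<^esub> a = a" using u(2) w(2) uc wc ac by (simp add: A.m_assoc)
      hence "(w \<otimes>\<^bsub>A\<^esub> u \<ominus>\<^bsub>A\<^esub> \<one>\<^bsub>A\<^esub>) \<otimes>\<^bsub>A\<^esub> a = \<zero>\<^bsub>A\<^esub>"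
        using uc wc ac by (simp add: A.minus_eq A.l_distr A.l_minus A.r_neg)
      moreover have "w \<otimes>\<^bsub>A\<^esub> u \<ominus>\<^bsub>A\<^esub> \<one>\<^bsub>A\<^esub> \<in> M"
        unfolding A.minus_eq using u w subringE(3,5,6,7)[OF Mr] by blast
      ultimately have "w \<otimes>\<^bsub>A\<^esub> u \<ominus>\<^bsub>A\<^esub> \<one>\<^bsub>A\<^esub> = \<zero>\<^bsub>A\<^esub>" using injM by blast
      thus ?thesis using uc wc by simp
    qed
    have "u \<otimes>\<^bsub>A\<^esub> w \<in> {\<zero>\<^bsub>A\<^esub>} +>\<^bsub>A\<^esub> \<one>\<^bsub>A\<^esub>"
    proof (rule ded[OF _ u(1) w(1)])
      show "ideal {\<zero>\<^bsub>A\<^esub>} ?M" using M.zeroideal by simp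
      show "w \<otimes>\<^bsub>A\<^esub> u \<in> {\<zero>\<^bsub>A\<^esub>} +>\<^bsub>A\<^esub> \<one>\<^bsub>A\<^esub>" unfolding wu a_r_coset_def' by simp
    qed
    hence "u \<otimes>\<^bsub>A\<^esub> w = \<one>\<^bsub>A\<^esub>" by (auto simp: a_r_coset_def')
    hence uU: "u \<in> Units ?M" using wu u w by (auto simp: Units_def)
    \<comment> \<open>The left inverse \<open>l\<close> comes from
      \<open>I <+> f = \<Lambda>\<close>. That it is also a right inverse is found in
      \<open>M\<close>, but \<open>l\<close> itself lies in \<open>\<Lambda>\<close>.\<close>
    have aU: "f +>\<^bsub>A\<^esub> a \<in> Units ?P"
    proof -
      have "\<one>\<^bsub>A\<^esub> \<in> (\<Lambda> #>\<^bsub>A\<^esub> a) <+>\<^bsub>A\<^esub> f" using I(2) a(2) subringE(3)[OF Lr] by simp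
      then obtain l p where l: "l \<in> \<Lambda>" "p \<in> f" "\<one>\<^bsub>A\<^esub> = l \<otimes>\<^bsub>A\<^esub> a \<oplus>\<^bsub>A\<^esub> p"
        unfolding set_add_def' r_coset_def by auto
      have carr: "l \<in> carrier A" "p \<in> carrier A" using l Lc fc by auto
      have "l \<otimes>\<^bsub>A\<^esub> a = \<ominus>\<^bsub>A\<^esub> p \<oplus>\<^bsub>A\<^esub> (l \<otimes>\<^bsub>A\<^esub> a \<oplus>\<^bsub>A\<^esub> p)" using carr ac by (simp add: A.a_comm[of _ p] A.r_neg1)
      moreover have "\<ominus>\<^bsub>A\<^esub> p \<in> f" using subgroup.m_inv_closed[OF f' l(2)] by (simp add: a_inv_def)
      ultimately have la: "l \<otimes>\<^bsub>A\<^esub> a \<in> f +>\<^bsub>A\<^esub> \<one>\<^bsub>A\<^esub>" unfolding a_r_coset_def' l(3) by blast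
      have "a \<otimes>\<^bsub>A\<^esub> l \<in> f +>\<^bsub>A\<^esub> \<one>\<^bsub>A\<^esub>" using ded[OF f(1) aM _ la] l(1) M(2) by auto
      thus ?thesis unfolding QL[OF aL] using la l(1) by blast
    qed
    have "f +>\<^bsub>A\<^esub> \<beta> = (f +>\<^bsub>A\<^esub> u) \<otimes>\<^bsub>units_of ?Q\<^esub> (f +>\<^bsub>A\<^esub> a)"
      using Qmult[OF u(1) aM] u(2) by (simp add: units_of_def)
    hence "\<pi>\<^sub>2 (\<nu> (f +>\<^bsub>A\<^esub> \<beta>)) = \<pi>\<^sub>2 (\<nu> (f +>\<^bsub>A\<^esub> u))"
      unfolding \<pi>\<^sub>2 using hom_image_coset_eq[OF GQ.group_axioms S \<nu>hom \<nu>comm _ aU] UM[OF uU]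
      by (simp add: units_of_carrier)
    also have "\<dots> = (\<pi>\<^sub>2 \<circ> f\<^sub>2) (reduced_norm A u)" using \<nu>nr[OF u(1) UM[OF uU]] f\<^sub>2 by simp
    finally show ?thesis using uU by blast
  qed

  \<comment> \<open>The explicit generator\<close>
  have generator: "inv\<^bsub>?M\<^esub> (v \<otimes>\<^bsub>A\<^esub> u) \<otimes>\<^bsub>A\<^esub> \<beta> \<in> \<Lambda> \<and> I = \<Lambda> #>\<^bsub>A\<^esub> (inv\<^bsub>?M\<^esub> (v \<otimes>\<^bsub>A\<^esub> u) \<otimes>\<^bsub>A\<^esub> \<beta>)"
    if u: "u \<in> Units ?M" and a: "a \<in> Units ?P" and v: "v \<in> SL A M O\<^sub>C"
      and eq: "f\<^sub>1 v = (f +>\<^bsub>A\<^esub> \<beta>) \<otimes>\<^bsub>?Q\<^esub> inv\<^bsub>?Q\<^esub> a \<otimes>\<^bsub>?Q\<^esub> inv\<^bsub>?Q\<^esub> (f +>\<^bsub>A\<^esub> u)" for u a v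
  proof -
    have vU: "v \<in> Units ?M" using v by (simp add: SL_def kernel_def units_of_carrier)
    define z where "z = v \<otimes>\<^bsub>A\<^esub> u"
    have zU: "z \<in> Units ?M" using M.Units_m_closed[OF vU u] by (simp add: z_def)
    define w where "w = inv\<^bsub>?M\<^esub> z"
    have wM: "w \<in> M" using M.Units_inv_closed[OF zU] by (simp add: w_def)
    have zM: "z \<in> M" and uM: "u \<in> M" and vM: "v \<in> M"
      using M.Units_closed zU u vU by auto
    have wz: "w \<otimes>\<^bsub>A\<^esub> z = \<one>\<^bsub>A\<^esub>" "z \<otimes>\<^bsub>A\<^esub> w = \<one>\<^bsub>A\<^esub>"
      using M.Units_l_inv[OF zU] M.Units_r_inv[OF zU] by (simp_all add: w_def)
    have carr: "w \<in> carrier A" "z \<in> carrier A" using wM zM Mc by auto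
    define \<alpha> where "\<alpha> = w \<otimes>\<^bsub>A\<^esub> \<beta>"
    have \<alpha>M: "\<alpha> \<in> M" unfolding \<alpha>_def using subringE(6)[OF Mr wM \<beta>(1)] .
    have aQ: "a \<in> Units ?Q" and uQ: "f +>\<^bsub>A\<^esub> u \<in> Units ?Q" using a SQ UM[OF u] by auto
    have "(f +>\<^bsub>A\<^esub> z) \<otimes>\<^bsub>?Q\<^esub> a = (f +>\<^bsub>A\<^esub> v) \<otimes>\<^bsub>?Q\<^esub> (f +>\<^bsub>A\<^esub> u) \<otimes>\<^bsub>?Q\<^esub> a"
      using Qmult[OF vM uM] by (simp add: z_def)
    also have "\<dots> = f +>\<^bsub>A\<^esub> \<beta>"
      using eq aQ uQ U\<beta> unfolding f\<^sub>1 by (simp add: Q.m_assoc Q.Units_closed)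
    finally have za: "(f +>\<^bsub>A\<^esub> z) \<otimes>\<^bsub>?Q\<^esub> a = f +>\<^bsub>A\<^esub> \<beta>" .
    obtain l where l: "l \<in> \<Lambda>" "a = f +>\<^bsub>A\<^esub> l"
      using P.Units_closed[OF a] by (auto simp: FactRing_def A_RCOSETS_def' cosL)
    have lM: "l \<in> M" using l M(2) by auto
    \<comment> \<open>Modulo \<open>f\<close>, \<open>\<beta>\<close> is \<open>z\<close> times
      \<open>a\<close>, so \<open>\<alpha>\<close> has the class \<open>a\<close> of
      \<open>l\<close>. Since \<open>f\<close> lies in \<open>\<Lambda>\<close>, so does
      \<open>\<alpha>\<close>.\<close>
    have "f +>\<^bsub>A\<^esub> \<alpha> = (f +>\<^bsub>A\<^esub> w) \<otimes>\<^bsub>?Q\<^esub> ((f +>\<^bsub>A\<^esub> z) \<otimes>\<^bsub>?Q\<^esub> a)"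
      unfolding za \<alpha>_def using Qmult[OF wM \<beta>(1)] by simp
    also have "\<dots> = f +>\<^bsub>A\<^esub> (w \<otimes>\<^bsub>A\<^esub> (z \<otimes>\<^bsub>A\<^esub> l))"
      unfolding l(2) using Qmult[OF zM lM] Qmult[OF wM subringE(6)[OF Mr zM lM]] by simp
    also have "w \<otimes>\<^bsub>A\<^esub> (z \<otimes>\<^bsub>A\<^esub> l) = l"
      using wz(1) carr l(1) Lc by (simp add: A.m_assoc[symmetric] subset_iff)
    finally have \<alpha>a: "f +>\<^bsub>A\<^esub> \<alpha> = f +>\<^bsub>A\<^esub> l" .
    have "\<alpha> \<in> f +>\<^bsub>A\<^esub> l"
      using M.rcoset_eq_iff[OF f(1), of \<alpha> l] \<alpha>a \<alpha>M lM by (simp add: cosM)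
    hence \<alpha>L: "\<alpha> \<in> \<Lambda>" using f(4) l(1) subringE(7)[OF Lr] by (auto simp: a_r_coset_def')
    obtain y where y: "y \<in> \<Lambda>" "\<alpha> \<otimes>\<^bsub>A\<^esub> y \<in> f +>\<^bsub>A\<^esub> \<one>\<^bsub>A\<^esub>" "y \<otimes>\<^bsub>A\<^esub> \<alpha> \<in> f +>\<^bsub>A\<^esub> \<one>\<^bsub>A\<^esub>"
      using a unfolding l(2) \<alpha>a[symmetric] QL[OF \<alpha>L] by blast
    \<comment> \<open>Both \<open>\<Lambda> #> \<alpha>\<close> and \<open>I\<close> are recovered
      from their extensions to \<open>M\<close>, and these extensions agree because \<open>z\<close>
      is a unit of \<open>M\<close>.\<close>
    have "\<Lambda> #>\<^bsub>A\<^esub> \<alpha> = (M #>\<^bsub>A\<^esub> \<alpha>) \<inter> \<Lambda>"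
      using y M(2) by (intro A.left_ideal_eq_inter_extension[OF Mr Lr M(2) f(1,4)
          A.left_ideal_cyclic[OF Lr \<alpha>L] A.cyclic_add_ideal[OF Lr fL \<alpha>L y(1,3)] \<alpha>M
          A.ideal_prod_cyclic[OF Mr Lr M(2) \<alpha>M] _ y(2)]) auto
    moreover have "I = (M #>\<^bsub>A\<^esub> \<beta>) \<inter> \<Lambda>"
      using A.left_ideal_eq_inter_extension[OF Mr Lr M(2) f(1,4) I \<beta> \<gamma>(1) \<beta>\<gamma>] .
    moreover have "M #>\<^bsub>A\<^esub> \<alpha> = M #>\<^bsub>A\<^esub> \<beta>"
    proof
      have \<beta>\<alpha>: "\<beta> = z \<otimes>\<^bsub>A\<^esub> \<alpha>"
        unfolding \<alpha>_def using carr \<beta>c wz(2) by (simp add: A.m_assoc[symmetric])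
      have 1: "m \<otimes>\<^bsub>A\<^esub> \<alpha> = (m \<otimes>\<^bsub>A\<^esub> w) \<otimes>\<^bsub>A\<^esub> \<beta>" "m \<otimes>\<^bsub>A\<^esub> \<beta> = (m \<otimes>\<^bsub>A\<^esub> z) \<otimes>\<^bsub>A\<^esub> \<alpha>" if "m \<in> M" for m
      proof -
        have "m \<in> carrier A" "\<alpha> \<in> carrier A" using that \<alpha>M Mc by auto
        thus "m \<otimes>\<^bsub>A\<^esub> \<alpha> = (m \<otimes>\<^bsub>A\<^esub> w) \<otimes>\<^bsub>A\<^esub> \<beta>" "m \<otimes>\<^bsub>A\<^esub> \<beta> = (m \<otimes>\<^bsub>A\<^esub> z) \<otimes>\<^bsub>A\<^esub> \<alpha>"
          using carr \<beta>c by (simp add: \<alpha>_def A.m_assoc, subst \<beta>\<alpha>, simp add: A.m_assoc)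
      qed
      show "M #>\<^bsub>A\<^esub> \<alpha> \<subseteq> M #>\<^bsub>A\<^esub> \<beta>" "M #>\<^bsub>A\<^esub> \<beta> \<subseteq> M #>\<^bsub>A\<^esub> \<alpha>"
        using 1 subringE(6)[OF Mr _ wM] subringE(6)[OF Mr _ zM] unfolding r_coset_def by blast+
    qed
    ultimately show ?thesis using \<alpha>L unfolding \<alpha>_def w_def z_def by simp
  qed

  \<comment> \<open>Preservation of the identity by \<open>\<nu>\<close>\<close>
  have \<nu>one: "\<nu> \<one>\<^bsub>units_of ?Q\<^esub> = \<one>\<^bsub>units_of ?T\<^esub>"
  proof (rule hom_surj_one[OF GQ.group_axioms \<nu>hom])
    show "\<nu> ` carrier (units_of ?Q) = carrier (units_of ?T)" using \<nu>img by (simp add: units_of_carrier)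
    have Cm: "x \<otimes>\<^bsub>A\<^esub> y \<in> C" if xy: "x \<in> C" "y \<in> C" for x y
      using A.centre_m_closed xy unfolding C by blast
    have gsub: "subgroup g (add_monoid A)"
    proof (rule A.add.subgroupI)
      show "g \<subseteq> carrier A" using fc g by auto
      have "\<zero>\<^bsub>A\<^esub> \<in> g" using subgroup.one_closed[OF f'] unfolding g C centre_def by simp
      thus "g \<noteq> {}" by blast
      fix x y assume x: "x \<in> g" and y: "y \<in> g"
      show "x \<oplus>\<^bsub>A\<^esub> y \<in> g" using subgroup.m_closed[OF f', of x y] Ccl x y unfolding g by auto
      have "\<ominus>\<^bsub>A\<^esub> x \<in> f" using subgroup.m_inv_closed[OF f', of x] x by (simp add: a_inv_def g)
      thus "\<ominus>\<^bsub>A\<^esub> x \<in> g" using x unfolding g C centre_def by (auto simp: A.l_minus A.r_minus)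
    qed
    have OC: "O\<^sub>C \<subseteq> C" unfolding O\<^sub>C integral_closure_def by blast
    \<comment> \<open>The unit law is checked on representatives: \<open>o'\<close> lies both in
      \<open>M\<close> and in the centre, so multiplication by it preserves \<open>f\<close> and
      \<open>C\<close>, hence \<open>g\<close>.\<close>
    have right: "rcoset_mult A g x (g +>\<^bsub>A\<^esub> \<one>\<^bsub>A\<^esub>) = x" if x: "x \<in> Units ?T" for x
    proof -
      obtain o' where o': "o' \<in> O\<^sub>C" "x = g +>\<^bsub>A\<^esub> o'" using Tc[OF x] by blast
      have oM: "o' \<in> M" and oC: "o' \<in> C" using o' OCM OC by auto
      have "o' \<otimes>\<^bsub>A\<^esub> i \<in> g" if "i \<in> g" for i
        using ideal.I_l_closed[OF f(1), of i o'] oM oC that Cm unfolding g by auto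
      moreover have "i \<otimes>\<^bsub>A\<^esub> j \<in> g" if "i \<in> g" "j \<in> g" for i j
        using ideal.I_r_closed[OF f(1), of i j] that Cm f(4) M(2) unfolding g by auto
      ultimately show ?thesis using A.rcoset_mult_one[OF gsub, of o'] oM Mc o'(2) by auto
    qed
    have "\<one>\<^bsub>A\<^esub> \<in> O\<^sub>C" unfolding O\<^sub>C \<O>
      using A.one_in_ring_of_integers[OF K(1)] by (intro A.one_in_integral_closure) (auto simp: C centre_def)
    hence "\<one>\<^bsub>?T\<^esub> \<in> carrier ?T" by (auto simp: FactRing_def A_RCOSETS_def' A.a_r_coset_subring)
    moreover have "\<one>\<^bsub>?T\<^esub> \<otimes>\<^bsub>?T\<^esub> \<one>\<^bsub>?T\<^esub> = \<one>\<^bsub>?T\<^esub>"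
    proof -
      have "i \<otimes>\<^bsub>A\<^esub> j \<in> g" if "i \<in> g" "j \<in> g" for i j
        using ideal.I_r_closed[OF f(1), of i j] that Cm f(4) M(2) unfolding g by auto
      moreover have "g \<subseteq> carrier A" using fc g by auto
      ultimately have "rcoset_mult A g (g +>\<^bsub>A\<^esub> \<one>\<^bsub>A\<^esub>) (g +>\<^bsub>A\<^esub> \<one>\<^bsub>A\<^esub>) = g +>\<^bsub>A\<^esub> \<one>\<^bsub>A\<^esub>"
        by (intro A.rcoset_mult_one[OF gsub]) auto
      thus ?thesis by (simp add: FactRing_def A.rcoset_mult_subring A.a_r_coset_subring)
    qed
    ultimately show "\<one>\<^bsub>units_of ?T\<^esub> \<in> carrier (units_of ?T)"
      by (auto simp: Units_def units_of_def)
    show "x \<otimes>\<^bsub>units_of ?T\<^esub> \<one>\<^bsub>units_of ?T\<^esub> = x" if "x \<in> carrier (units_of ?T)" for x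
      using right that unfolding Tmult Tone by (simp add: units_of_carrier)
  qed

  \<comment> \<open>The sufficient condition\<close>
  have converse: "(\<exists>\<alpha>\<in>\<Lambda>. I = \<Lambda> #>\<^bsub>A\<^esub> \<alpha>) \<and> (full A K I \<longrightarrow> free_left_module A \<Lambda> I)"
    if surj: "f\<^sub>1 ` SL A M O\<^sub>C = SL_mod A M f O\<^sub>C g \<nu>"
      and mem: "\<pi>\<^sub>2 (\<nu> (f +>\<^bsub>A\<^esub> \<beta>)) \<in> (\<pi>\<^sub>2 \<circ> f\<^sub>2) ` (reduced_norm A ` Units ?M)"
  proof -
    obtain u where u: "u \<in> Units ?M" "\<pi>\<^sub>2 (\<nu> (f +>\<^bsub>A\<^esub> \<beta>)) = \<pi>\<^sub>2 (f\<^sub>2 (reduced_norm A u))" using mem by auto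
    have uM: "u \<in> M" using M.Units_closed[OF u(1)] by simp
    have "\<pi>\<^sub>2 (\<nu> (f +>\<^bsub>A\<^esub> \<beta>)) = \<pi>\<^sub>2 (\<nu> (f +>\<^bsub>A\<^esub> u))"
      using u(2) \<nu>nr[OF uM UM[OF u(1)]] f\<^sub>2 by simp
    then obtain s where s: "s \<in> Units ?P" "\<nu> (f +>\<^bsub>A\<^esub> \<beta>) = \<nu> (f +>\<^bsub>A\<^esub> u) \<otimes>\<^bsub>units_of ?T\<^esub> \<nu> s"
      using hom_image_coset_eqD[OF GQ.group_axioms S \<nu>hom \<nu>comm] UM[OF u(1)] U\<beta> 
      unfolding \<pi>\<^sub>2 units_of_carrier by blast
    have sQ: "s \<in> Units ?Q" using s SQ by auto
    \<comment> \<open>This is the class that has to be lifted to an element of reduced norm one;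
      surjectivity of \<open>f\<^sub>1\<close> provides the lift \<open>v\<close>.\<close>
    have "(f +>\<^bsub>A\<^esub> \<beta>) \<otimes>\<^bsub>units_of ?Q\<^esub> inv\<^bsub>units_of ?Q\<^esub> s \<otimes>\<^bsub>units_of ?Q\<^esub> inv\<^bsub>units_of ?Q\<^esub> (f +>\<^bsub>A\<^esub> u)
        \<in> SL_mod A M f O\<^sub>C g \<nu>"
      unfolding SL_mod_def using U\<beta> sQ UM[OF u(1)] s(2)
      by (intro hom_quotient_in_kernel[OF GQ.group_axioms \<nu>hom \<nu>one]) (auto simp: units_of_carrier)
    hence "(f +>\<^bsub>A\<^esub> \<beta>) \<otimes>\<^bsub>?Q\<^esub> inv\<^bsub>?Q\<^esub> s \<otimes>\<^bsub>?Q\<^esub> inv\<^bsub>?Q\<^esub> (f +>\<^bsub>A\<^esub> u) \<in> f\<^sub>1 ` SL A M O\<^sub>C"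
      unfolding surj using Q.units_of_inv[OF sQ] Q.units_of_inv[OF UM[OF u(1)]] by (simp add: units_of_mult)
    then obtain v where v: "v \<in> SL A M O\<^sub>C"
      "(f +>\<^bsub>A\<^esub> \<beta>) \<otimes>\<^bsub>?Q\<^esub> inv\<^bsub>?Q\<^esub> s \<otimes>\<^bsub>?Q\<^esub> inv\<^bsub>?Q\<^esub> (f +>\<^bsub>A\<^esub> u) = f\<^sub>1 v"
      by (rule imageE)
    obtain \<alpha> where \<alpha>: "\<alpha> \<in> \<Lambda>" "I = \<Lambda> #>\<^bsub>A\<^esub> \<alpha>"
      using generator[OF u(1) s(1) v(1) v(2)[symmetric]] by blast
    \<comment> \<open>A cyclic ideal can be annihilated by a simple component: with
      \<open>\<Lambda>\<close> and \<open>M\<close> both equal to Z x Z, the ideal 0 x Z is cyclic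
      and comaximal with Z x 2Z, but not free. Fullness of \<open>I\<close> excludes this by making
      right multiplication by \<open>\<alpha>\<close> injective.\<close>
    moreover have "free_left_module A \<Lambda> I" if "full A K I"
    proof -
      have "I \<subseteq> carrier A #>\<^bsub>A\<^esub> \<alpha>" using \<alpha>(2) Lc unfolding r_coset_def by auto
      moreover have "I \<subseteq> carrier A" and \<alpha>c: "\<alpha> \<in> carrier A" using I'(1) Lc \<alpha>(1) by auto
      ultimately have "l = \<zero>\<^bsub>A\<^esub>" if "l \<in> carrier A" "l \<otimes>\<^bsub>A\<^esub> \<alpha> = \<zero>\<^bsub>A\<^esub>" for l
        using A.full_subset_principal_imp_injective[OF K(2) \<open>full A K I\<close> _ _ _ that] by blast
      thus ?thesis unfolding \<alpha>(2)
        using A.cyclic_imp_free_left_module[OF Lc subringE(2,3)[OF Lr] \<alpha>c] by blast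
    qed
    ultimately show ?thesis by blast
  qed
  show ?thesis using U\<beta> free_imp converse generator by blast
qed

end
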